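(* Fix $n\ge2$, $B>0$ and let $\pi_0$ be any prior distribution on $\Theta(B)$. Draw $(\tau,\mu_{\mathrm{L}},\mu_{\mathrm{R}})\sim\pi_0$, $\boldsymbol{X}\sim P(n,\tau,\mu_{\mathrm{L}},\mu_{\mathrm{R}})$ and set $Y=\mathbb{1}\{\mu_{\mathrm{L}}\ne\mu_{\mathrm{R}}\}$. Suppose the training data $\mathcal{D}=((\boldsymbol{X}^{(1)},Y^{(1)}),\ldots,(\boldsymbol{X}^{(N)},Y^{(N)}))$ consist of independent copies of $(\boldsymbol{X},Y)$, and let $h_{\mathrm{ERM}}\in\arg\min_{h\in\mathcal{H}_{1,2n-2}}L_N(h)$ be an empirical risk minimiser. There exists a universal constant $C>0$ such that for any $\delta\in(0,1)$, with probability at least $1-\delta$, $$\mathbb{P}(h_{\mathrm{ERM}}(\boldsymbol{X})\ne Y\mid\mathcal{D})\le n e^{-nB^2/8}+C\sqrt{\frac{n^2\log(n)\log(N)+\log(1/\delta)}{N}},$$ where $(\boldsymbol{X},Y)$ on the left is a fresh copy independent of $\mathcal{D}$.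
   Context: $P(n,\tau,\mu_{\mathrm{L}},\mu_{\mathrm{R}})$ is the law of $N_n(\boldsymbol{\mu},I_n)$ with $\mu_i=\mu_{\mathrm{L}}\mathbb{1}\{i\le\tau\}+\mu_{\mathrm{R}}\mathbb{1}\{i>\tau\}$. $\Theta(B)=\{(\tau,\mu_{\mathrm{L}},\mu_{\mathrm{R}})\in[n-1]\times\mathbb{R}^2: |\mu_{\mathrm{L}}-\mu_{\mathrm{R}}|\sqrt{\tau(n-\tau)}/n\in\{0\}\cup(B,\infty)\}$. Empirical risk: $L_N(h)=N^{-1}\sum_{i=1}^N\mathbb{1}\{Y^{(i)}\ne h(\boldsymbol{X}^{(i)})\}$. Neural network classes: for $L\ge1$ and widths $\boldsymbol{m}=(m_1,\ldots,m_L)$, $m_0=n$, $m_{L+1}=1$; $\sigma_{\boldsymbol{b}}(y)=(\max(y_j-b_j,0))_j$; $\mathcal{H}_{L,\boldsymbol{m}}$ is the class of $h:\mathbb{R}^n\to\{0,1\}$, $h(\boldsymbol{x})=\sigma^*_\lambda W_L\sigma_{\boldsymbol{b}_L}\cdots W_1\sigma_{\boldsymbol{b}_1}W_0\boldsymbol{x}$ with $\sigma^*_\lambda(x)=\mathbb{1}\{x>\lambda\}$, $\lambda>0$, $W_\ell\in\mathbb{R}^{m_{\ell+1}\times m_\ell}$, $\boldsymbol{b}_\ell\in\mathbb{R}^{m_\ell}$; $\mathcal{H}_{1,m}$ is the one-hidden-layer class of width $m$.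
   Formalization: The sample size is assumed to satisfy N ≥ 2; for N = 1 the log(N) term vanishes and the claim fails, since a constant classifier can be an empirical risk minimiser with risk 1/2 while the bound tends to n e^{-nB²/8} as δ → 1. *)

theory Defs
  imports "HOL-Probability.Probability"
begin

text \<open>Observations are vectors in R^n, represented as functions nat => real with
  coordinates indexed by {1..n} (extensional outside, as in PiM). Labels in {0,1}
  are represented by bool (True = 1).\<close>

definition mean_vec :: "nat \<Rightarrow> nat \<Rightarrow> real \<Rightarrow> real \<Rightarrow> nat \<Rightarrow> real" where
  "mean_vec n \<tau> muL muR i = (if i \<le> \<tau> then muL else muR)"

definition CP :: "nat \<Rightarrow> nat \<Rightarrow> real \<Rightarrow> real \<Rightarrow> (nat \<Rightarrow> real) measure" where
  "CP n \<tau> muL muR =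
     PiM {1..n} (\<lambda>i. density lborel (normal_density (mean_vec n \<tau> muL muR i) 1))"

definition Theta :: "nat \<Rightarrow> real \<Rightarrow> (nat \<times> real \<times> real) set" where
  "Theta n B = {(\<tau>, muL, muR). \<tau> \<in> {1..n-1} \<and>
     (let s = \<bar>muL - muR\<bar> * sqrt (real \<tau> * real (n - \<tau>)) / real n in s = 0 \<or> s > B)}"

definition data_space :: "nat \<Rightarrow> ((nat \<Rightarrow> real) \<times> bool) measure" where
  "data_space n = PiM {1..n} (\<lambda>_. lborel) \<Otimes>\<^sub>M count_space UNIV"

definition XY_law :: "nat \<Rightarrow> (nat \<times> real \<times> real) measure \<Rightarrow> ((nat \<Rightarrow> real) \<times> bool) measure" where
  "XY_law n \<pi>0 = \<pi>0 \<bind> (\<lambda>(\<tau>, muL, muR).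
      distr (CP n \<tau> muL muR) (data_space n) (\<lambda>x. (x, muL \<noteq> muR)))"

definition train_law :: "nat \<Rightarrow> (nat \<times> real \<times> real) measure \<Rightarrow> nat
    \<Rightarrow> (nat \<Rightarrow> (nat \<Rightarrow> real) \<times> bool) measure" where
  "train_law n \<pi>0 N = PiM {..<N} (\<lambda>_. XY_law n \<pi>0)"

definition emp_risk :: "nat \<Rightarrow> ((nat \<Rightarrow> real) \<Rightarrow> bool) \<Rightarrow> (nat \<Rightarrow> (nat \<Rightarrow> real) \<times> bool) \<Rightarrow> real" where
  "emp_risk N h D = (\<Sum>i<N. if h (fst (D i)) \<noteq> snd (D i) then 1 else 0) / real N"

definition H1 :: "nat \<Rightarrow> nat \<Rightarrow> ((nat \<Rightarrow> real) \<Rightarrow> bool) set" where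
  "H1 n m = {h. \<exists>(W0 :: nat \<Rightarrow> nat \<Rightarrow> real) (b :: nat \<Rightarrow> real) (W1 :: nat \<Rightarrow> real) (lam :: real).
      lam > 0 \<and>
      h = (\<lambda>x. (\<Sum>j<m. W1 j * max ((\<Sum>i\<in>{1..n}. W0 j i * x i) - b j) 0) > lam)}"

definition risk :: "nat \<Rightarrow> (nat \<times> real \<times> real) measure \<Rightarrow> ((nat \<Rightarrow> real) \<Rightarrow> bool) \<Rightarrow> real" where
  "risk n \<pi>0 h = measure (XY_law n \<pi>0) {p \<in> space (XY_law n \<pi>0). h (fst p) \<noteq> snd p}"

end

theory Submission
  imports Defs "HOL-Real_Asymp.Real_Asymp"
begin

text \<open>The test that rejects when some CUSUM statistic exceeds \<open>sqrt n B / 2\<close> in absolute value is a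
  network with \<open>2 n - 2\<close> hidden units, and Gaussian tails with a union bound control its risk. It
  remains to bound the one-sided deviations between risk and empirical risk uniformly over the
  network class. Once the activation pattern of the hidden units on the sample is fixed, the network
  is a linear classifier in the products of its weights, so Sauer--Shelah, applied to the hidden units
  and then to the output, bounds the number of labellings of \<open>M\<close> points by \<open>M + 1\<close> to a power of
  order \<open>n\<^sup>2\<close>. A ghost sample (via Jensen), random swaps and \<open>cosh x \<le> exp (x\<^sup>2 / 2)\<close> turn this
  count into an exponential tail bound for the supremum. Measurability is no obstacle because every
  network is a pointwise limit of networks with rational weights.\<close>

section \<open>Sauer--Shelah bound for linear classifiers and shallow networks\<close>

text \<open>The minimiser depends on the sample, so it is controlled only through an event on which
  every network of the class behaves well at once. The network it is compared with depends on
  \<open>n\<close> and \<open>B\<close> alone; for that one a class with a single member suffices,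
  applied to the complement of its error set so that the one-sided bound yields the opposite
  direction. Symmetrization acts on \<open>exp (e * gap)\<close> rather than on probabilities.
  Jensen then compares the sample with the ghost sample without halving the radius and without a
  lower bound on \<open>N * e\<^sup>2\<close>. The same \<open>e\<close> serves as radius and as
  exponential parameter, because \<open>s = e\<close> minimises the exponent
  \<open>- s * N * e + N * s\<^sup>2 / 2\<close>. The rate \<open>B\<^sup>2 / 8\<close> comes from
  placing the test threshold half way between the null mean 0 and the smallest possible mean
  \<open>sqrt n * B\<close> under a change.\<close>

definition shattered_by :: "'a set set \<Rightarrow> 'a set \<Rightarrow> bool" where
  "shattered_by F A \<longleftrightarrow> (\<lambda>B. B \<inter> A) ` F = Pow A"

lemma shattered_byI: "(\<And>B. B \<subseteq> A \<Longrightarrow> \<exists>X\<in>F. X \<inter> A = B) \<Longrightarrow> shattered_by F A"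
  unfolding shattered_by_def by (auto simp: image_iff)

lemma shattered_byE:
  assumes "shattered_by F A" "B \<subseteq> A"
  obtains X where "X \<in> F" "X \<inter> A = B"
  using assms unfolding shattered_by_def by (metis PowI imageE)

lemma shattered_by_mono: "shattered_by F A \<Longrightarrow> F \<subseteq> G \<Longrightarrow> shattered_by G A"
  by (meson shattered_byE shattered_byI subsetD)

text \<open>Pajor's form of the Sauer--Shelah lemma. Counting shattered sets, instead of bounding
  their size, lets the induction on the ground set run without a dimension parameter.\<close>

lemma card_le_card_shattered:
  assumes "finite I" "F \<subseteq> Pow I"
  shows "card F \<le> card {A. A \<subseteq> I \<and> shattered_by F A}"
  using assms
proof (induction I arbitrary: F rule: finite_induct)
  case empty
  show ?case
  proof (cases "F = {}")
    case False
    then have F: "F = {{}}" using empty by auto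
    have "{A. A \<subseteq> {} \<and> shattered_by F A} = {{}}"
      by (auto simp: F shattered_by_def)
    then show ?thesis by (simp add: F)
  qed simp
next
  case (insert a I)
  define F0 where "F0 = {X \<in> F. a \<notin> X}"
  define F1 where "F1 = {X. a \<notin> X \<and> insert a X \<in> F}"
  define S where "S G = {A. A \<subseteq> I \<and> shattered_by G A}" for G
  have fin: "finite F"
    by (meson finite_Pow_iff finite_insert finite_subset insert)
  have sub: "F0 \<subseteq> Pow I" "F1 \<subseteq> Pow I"
    using insert.prems by (auto simp: F0_def F1_def)
  then have fin01: "finite F0" "finite F1"
    by (auto simp: insert.hyps intro: finite_subset)
  have Fsplit: "F = F0 \<union> insert a ` F1"
  proof (intro set_eqI iffI)
    fix X assume X: "X \<in> F"
    show "X \<in> F0 \<union> insert a ` F1"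
    proof (cases "a \<in> X")
      case True
      then have "X = insert a (X - {a})" "X - {a} \<in> F1"
        using X by (auto simp: F1_def insert_absorb)
      then show ?thesis by blast
    qed (use X in \<open>simp add: F0_def\<close>)
  qed (auto simp: F0_def F1_def)
  have inj: "inj_on (insert a) F1"
    by (rule inj_onI) (auto simp: F1_def dest!: insert_ident[THEN iffD1, rotated 2])
  have finS: "finite (S G)" for G
    by (auto simp: S_def insert.hyps)
  have inS: "insert a A \<notin> S G" for A G
    using insert.hyps by (auto simp: S_def)
  \<comment> \<open>A set shattered by both halves is counted twice by the induction hypotheses; it
    pays for the second count by making \<open>insert a A\<close> shattered as well.\<close>
  have both: "shattered_by F (insert a A)" if A: "A \<in> S F0 \<inter> S F1" for A
  proof (rule shattered_byI)
    fix B assume B: "B \<subseteq> insert a A"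
    have aA: "a \<notin> A" using A insert.hyps by (auto simp: S_def)
    show "\<exists>X\<in>F. X \<inter> insert a A = B"
    proof (cases "a \<in> B")
      case True
      obtain X where "X \<in> F1" "X \<inter> A = B - {a}"
        using A B by (auto simp: S_def elim!: shattered_byE[of F1 A "B - {a}"])
      then have "insert a X \<in> F" "insert a X \<inter> insert a A = B"
        using True by (auto simp: F1_def)
      then show ?thesis by blast
    next
      case False
      obtain X where "X \<in> F0" "X \<inter> A = B"
        using A B False by (auto simp: S_def elim!: shattered_byE[of F0 A B])
      then have "X \<in> F" "X \<inter> insert a A = B"
        by (auto simp: F0_def)
      then show ?thesis by blast
    qed
  qed
  have one: "shattered_by F A" if A: "A \<in> S F0 \<union> S F1" for A
  proof (cases "A \<in> S F0")
    case True
    then show ?thesis by (auto simp: S_def F0_def intro: shattered_by_mono)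
  next
    case False
    then have A: "A \<in> S F1" using A by blast
    show ?thesis
    proof (rule shattered_byI)
      fix B assume "B \<subseteq> A"
      then obtain X where X: "X \<in> F1" "X \<inter> A = B"
        using A unfolding S_def by (blast elim: shattered_byE)
      have "a \<notin> A" using A insert.hyps by (auto simp: S_def)
      then have "insert a X \<inter> A = B" using X by auto
      moreover have "insert a X \<in> F" using X by (simp add: F1_def)
      ultimately show "\<exists>X\<in>F. X \<inter> A = B" by blast
    qed
  qed
  have "card F \<le> card F0 + card F1"
    using card_Un_le[of F0 "insert a ` F1"] card_image[OF inj] by (simp add: Fsplit)
  also have "\<dots> \<le> card (S F0) + card (S F1)"
    using insert.IH[OF sub(1)] insert.IH[OF sub(2)] by (simp add: S_def)
  also have "\<dots> = card (S F0 \<union> S F1) + card (S F0 \<inter> S F1)"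
    by (rule card_Un_Int[OF finS finS])
  also have "card (S F0 \<inter> S F1) = card (insert a ` (S F0 \<inter> S F1))"
    by (rule card_image[symmetric], rule inj_onI)
       (use insert.hyps in \<open>auto simp: S_def dest!: insert_ident[THEN iffD1, rotated 2]\<close>)
  also have "card (S F0 \<union> S F1) + card (insert a ` (S F0 \<inter> S F1))
      = card ((S F0 \<union> S F1) \<union> insert a ` (S F0 \<inter> S F1))"
    using inS by (intro card_Un_disjoint[symmetric]) (auto simp: finS)
  also have "\<dots> \<le> card {A. A \<subseteq> insert a I \<and> shattered_by F A}"
  proof (rule card_mono)
    show "finite {A. A \<subseteq> insert a I \<and> shattered_by F A}"
      using insert.hyps by simp
    show "S F0 \<union> S F1 \<union> insert a ` (S F0 \<inter> S F1) \<subseteq> {A. A \<subseteq> insert a I \<and> shattered_by F A}"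
      using one both by (auto simp: S_def)
  qed
  finally show ?case .
qed

text \<open>Termwise comparison with the binomial expansion of the right side:
  \<open>card I choose k \<le> card I ^ k\<close>, and \<open>d choose k\<close> is at least 1 for
  \<open>k \<le> d\<close>. The bound also holds when \<open>d\<close> exceeds
  \<open>card I\<close>.\<close>

lemma card_subsets_le:
  assumes "finite I"
  shows "card {A. A \<subseteq> I \<and> card A \<le> d} \<le> (card I + 1) ^ d"
proof -
  have eq: "{A. A \<subseteq> I \<and> card A \<le> d} = (\<Union>k\<le>d. {A. A \<subseteq> I \<and> card A = k})"
    by blast
  have "card {A. A \<subseteq> I \<and> card A \<le> d} \<le> (\<Sum>k\<le>d. card {A. A \<subseteq> I \<and> card A = k})"
    unfolding eq by (rule card_UN_le) simp
  also have "\<dots> = (\<Sum>k\<le>d. card I choose k)"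
    using n_subsets[OF assms] by simp
  also have "\<dots> \<le> (\<Sum>k\<le>d. (d choose k) * card I ^ k)"
  proof (rule sum_mono)
    fix k assume k: "k \<in> {..d}"
    have "card I choose k \<le> card I ^ k"
      by (cases "k \<le> card I") (simp_all add: binomial_le_pow binomial_eq_0)
    also have "\<dots> \<le> (d choose k) * card I ^ k"
      using k by (simp add: Suc_leI)
    finally show "card I choose k \<le> (d choose k) * card I ^ k" .
  qed
  also have "\<dots> = (card I + 1) ^ d"
    by (subst binomial_ring) simp
  finally show ?thesis .
qed

text \<open>A homogeneous system with more unknowns than equations has a nontrivial solution:
  Gaussian elimination, one equation per induction step.\<close>

lemma exists_linear_relation:
  fixes \<phi> :: "'k \<Rightarrow> 'i \<Rightarrow> real"
  assumes "finite K" "finite S" "card K < card S"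
  shows "\<exists>a. (\<exists>s\<in>S. a s \<noteq> 0) \<and> (\<forall>k\<in>K. (\<Sum>s\<in>S. a s * \<phi> k s) = 0)"
  using assms
proof (induction K arbitrary: S \<phi> rule: finite_induct)
  case empty
  then have "S \<noteq> {}" by auto
  then show ?case by (intro exI[of _ "\<lambda>_. 1"]) auto
next
  case (insert d K)
  show ?case
  proof (cases "\<forall>s\<in>S. \<phi> d s = 0")
    case True
    obtain a where "\<exists>s\<in>S. a s \<noteq> 0" "\<forall>k\<in>K. (\<Sum>s\<in>S. a s * \<phi> k s) = 0"
      using insert.IH[of S \<phi>] insert.prems insert.hyps by auto
    then show ?thesis using True by (intro exI[of _ a]) auto
  next
    case False
    then obtain t where t: "t \<in> S" "\<phi> d t \<noteq> 0" by auto
    \<comment> \<open>Equation \<open>d\<close> is solved for the unknown at the pivot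
      \<open>t\<close> and substituted into the others; \<open>\<psi>\<close> holds the reduced
      coefficients.\<close>
    define \<psi> where "\<psi> k s = \<phi> k s - \<phi> d s * \<phi> k t / \<phi> d t" for k s
    have "card K < card (S - {t})"
      using insert t by auto
    then obtain a where a: "\<exists>s\<in>S-{t}. a s \<noteq> 0" "\<forall>k\<in>K. (\<Sum>s\<in>S-{t}. a s * \<psi> k s) = 0"
      using insert.IH[of "S - {t}" \<psi>] insert.prems by auto
    define c where "c = (\<Sum>s\<in>S-{t}. a s * \<phi> d s)"
    define a' where "a' = a(t := - c / \<phi> d t)"
    have split: "(\<Sum>s\<in>S. a' s * \<phi> k s) = (\<Sum>s\<in>S-{t}. a s * \<phi> k s) - c / \<phi> d t * \<phi> k t" for k
      using insert.prems t by (subst sum.remove[of S t]) (auto simp: a'_def intro!: sum.cong)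
    have "(\<Sum>s\<in>S. a' s * \<phi> k s) = 0" if k: "k \<in> K" for k
    proof -
      have "(\<Sum>s\<in>S-{t}. a s * \<psi> k s) = (\<Sum>s\<in>S-{t}. a s * \<phi> k s) - c / \<phi> d t * \<phi> k t"
        by (simp add: \<psi>_def c_def algebra_simps sum_subtractf sum_distrib_left sum_distrib_right sum_divide_distrib)
      then show ?thesis using a(2) k split[of k] by auto
    qed
    moreover have "(\<Sum>s\<in>S. a' s * \<phi> d s) = 0"
      using split[of d] t by (simp add: c_def)
    moreover have "\<exists>s\<in>S. a' s \<noteq> 0"
      using a(1) by (auto simp: a'_def)
    ultimately show ?thesis by blast
  qed
qed

section \<open>Patterns of linear threshold classifiers\<close>

definition linear_patterns :: "'i set \<Rightarrow> 'k set \<Rightarrow> ('k \<Rightarrow> 'i \<Rightarrow> real) \<Rightarrow> 'i set set" where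
  "linear_patterns I K \<phi> = range (\<lambda>w. {i\<in>I. (\<Sum>k\<in>K. w k * \<phi> k i) > 0})"

lemma linear_patternsI: "{i\<in>I. (\<Sum>k\<in>K. w k * \<phi> k i) > 0} \<in> linear_patterns I K \<phi>"
  by (auto simp: linear_patterns_def)

text \<open>A linear relation among the points passes to the scores of every classifier. A
  classifier labelling exactly the points with positive coefficient by 1 would make every term of
  that relation nonnegative and one term positive.\<close>

lemma card_shattered_by_linear_patterns:
  assumes "finite K" "finite S" "shattered_by (linear_patterns I K \<phi>) S" "S \<subseteq> I"
  shows "card S \<le> card K"
proof (rule ccontr)
  assume "\<not> card S \<le> card K"
  then obtain a0 where a0: "\<exists>s\<in>S. a0 s \<noteq> 0" "\<forall>k\<in>K. (\<Sum>s\<in>S. a0 s * \<phi> k s) = 0"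
    using exists_linear_relation[of K S \<phi>] assms by auto
  \<comment> \<open>Label 0 only says that the score is at most 0, so strictness must come from a
    point with positive coefficient. Changing the sign of \<open>a0\<close> provides one if
    necessary.\<close>
  have "\<exists>a. (\<exists>s\<in>S. a s > 0) \<and> (\<forall>k\<in>K. (\<Sum>s\<in>S. a s * \<phi> k s) = 0)"
  proof (cases "\<exists>s\<in>S. a0 s > 0")
    case False
    then show ?thesis using a0
      by (intro exI[of _ "\<lambda>s. - a0 s"]) (auto simp: sum_negf not_less order_le_less)
  qed (use a0 in blast)
  then obtain a where a: "\<exists>s\<in>S. a s > 0" "\<forall>k\<in>K. (\<Sum>s\<in>S. a s * \<phi> k s) = 0" by blast
  obtain X where X: "X \<in> linear_patterns I K \<phi>" "X \<inter> S = {s\<in>S. a s > 0}"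
    using assms(3) by (rule shattered_byE[where B = "{s\<in>S. a s > 0}"]) auto
  then obtain w where w: "X = {i\<in>I. (\<Sum>k\<in>K. w k * \<phi> k i) > 0}"
    by (auto simp: linear_patterns_def)
  have pos: "(\<Sum>k\<in>K. w k * \<phi> k s) > 0 \<longleftrightarrow> a s > 0" if "s \<in> S" for s
    using X(2) that assms(4) unfolding w by blast
  have "0 < (\<Sum>s\<in>S. a s * (\<Sum>k\<in>K. w k * \<phi> k s))"
  proof -
    obtain s where s: "s \<in> S" "a s > 0" using a(1) by blast
    show ?thesis
    proof (rule sum_pos2[OF assms(2) s(1)])
      show "0 < a s * (\<Sum>k\<in>K. w k * \<phi> k s)" using s pos by simp
      show "0 \<le> a s * (\<Sum>k\<in>K. w k * \<phi> k s)" if "s \<in> S" for s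
        using pos[OF that] by (metis less_eq_real_def linorder_not_less mult_nonneg_nonneg mult_nonpos_nonpos)
    qed
  qed
  also have "\<dots> = (\<Sum>k\<in>K. w k * (\<Sum>s\<in>S. a s * \<phi> k s))"
    by (simp add: sum_distrib_left sum.swap[of _ K] algebra_simps)
  also have "\<dots> = 0" using a(2) by simp
  finally show False by simp
qed

lemma card_linear_patterns_le:
  assumes "finite K" "finite I"
  shows "card (linear_patterns I K \<phi>) \<le> (card I + 1) ^ card K"
proof -
  have "card (linear_patterns I K \<phi>) \<le> card {A. A \<subseteq> I \<and> shattered_by (linear_patterns I K \<phi>) A}"
    by (rule card_le_card_shattered) (auto simp: assms linear_patterns_def)
  also have "\<dots> \<le> card {A. A \<subseteq> I \<and> card A \<le> card K}"
  proof (rule card_mono)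
    show "{A. A \<subseteq> I \<and> shattered_by (linear_patterns I K \<phi>) A} \<subseteq> {A. A \<subseteq> I \<and> card A \<le> card K}"
      using card_shattered_by_linear_patterns[of K _ I \<phi>] assms by (auto intro: finite_subset)
  qed (use assms in simp)
  also have "\<dots> \<le> (card I + 1) ^ card K"
    by (rule card_subsets_le[OF assms(2)])
  finally show ?thesis .
qed

section \<open>Labellings realised by shallow networks\<close>

definition patterns :: "('a \<Rightarrow> bool) set \<Rightarrow> (nat \<Rightarrow> 'a) \<Rightarrow> nat \<Rightarrow> nat set set" where
  "patterns H x M = (\<lambda>h. {i\<in>{..<M}. h (x i)}) ` H"

text \<open>Once it is known which hidden units are active at which sample points, the output of the
  network is linear in the products of inner and outer weights.\<close>

lemma card_patterns_H1_le:
  shows "finite (patterns (H1 n m) x M)"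
    and "card (patterns (H1 n m) x M) \<le> (M + 1) ^ (2 * m * (n + 1) + 1)"
proof -
  define I where "I = {..<M}"
  \<comment> \<open>Coordinate 0 is the constant -1, which turns a bias into the weight of an
    ordinary feature.\<close>
  define aff :: "nat \<Rightarrow> nat \<Rightarrow> real" where "aff k i = (if k = 0 then -1 else x i k)" for k i
  define U where "U = linear_patterns I {..n} aff"
  \<comment> \<open>\<open>None\<close> stands for the output threshold and
    \<open>Some (j, k)\<close> for the product of outer weight \<open>j\<close> with inner weight
    \<open>(j, k)\<close>. Treating these products as free parameters can only enlarge the set of
    patterns.\<close>
  define K where "K = insert None (Some ` ({..<m} \<times> {..n}))"
  define \<psi> :: "(nat \<Rightarrow> nat set) \<Rightarrow> (nat \<times> nat) option \<Rightarrow> nat \<Rightarrow> real" where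
    "\<psi> S p i = (case p of None \<Rightarrow> -1 | Some (j, k) \<Rightarrow> if i \<in> S j then aff k i else 0)" for S p i
  have fin: "finite I" "finite K" "card I = M" by (simp_all add: I_def K_def)
  have cardK: "card K = m * (n + 1) + 1"
    unfolding K_def by (subst card_insert_disjoint) (auto simp: card_image)
  have finlin: "finite (linear_patterns I L \<phi>)" for L :: "'l set" and \<phi>
    by (rule finite_subset[of _ "Pow I"]) (auto simp: linear_patterns_def fin)
  have sub: "patterns (H1 n m) x M \<subseteq> (\<Union>S\<in>PiE {..<m} (\<lambda>_. U). linear_patterns I K (\<psi> S))"
  proof
    fix P assume "P \<in> patterns (H1 n m) x M"
    then obtain W0 b W1 lam where P:
      "P = {i\<in>I. (\<Sum>j<m. W1 j * max ((\<Sum>k\<in>{1..n}. W0 j k * x i k) - b j) 0) > (lam::real)}"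
      by (auto simp: patterns_def H1_def I_def)
    define w where "w j k = (if k = 0 then b j else W0 j k)" for j k :: nat
    have pre: "(\<Sum>k\<in>{1..n}. W0 j k * x i k) - b j = (\<Sum>k\<le>n. w j k * aff k i)" for i j
    proof -
      have "{..n} = insert 0 {1..n}" by auto
      then show ?thesis by (auto simp: w_def aff_def intro!: sum.cong)
    qed
    define S where "S = (\<lambda>j\<in>{..<m}. {i\<in>I. (\<Sum>k\<le>n. w j k * aff k i) > 0})"
    define v where "v p = (case p of None \<Rightarrow> lam | Some (j, k) \<Rightarrow> W1 j * w j k)" for p :: "(nat \<times> nat) option"
    have S: "S \<in> PiE {..<m} (\<lambda>_. U)"
      by (auto simp: S_def U_def intro!: linear_patternsI)
    have "(\<Sum>j<m. W1 j * max ((\<Sum>k\<in>{1..n}. W0 j k * x i k) - b j) 0) > lam \<longleftrightarrow>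
        (\<Sum>p\<in>K. v p * \<psi> S p i) > 0" if i: "i \<in> I" for i
    proof -
      have "(\<Sum>p\<in>K. v p * \<psi> S p i) = - lam + (\<Sum>j<m. \<Sum>k\<le>n. v (Some (j, k)) * \<psi> S (Some (j, k)) i)"
        unfolding K_def
        by (subst sum.insert) (auto simp: sum.reindex sum.cartesian_product v_def \<psi>_def intro!: sum.cong)
      also have "(\<Sum>j<m. \<Sum>k\<le>n. v (Some (j, k)) * \<psi> S (Some (j, k)) i)
          = (\<Sum>j<m. W1 j * max (\<Sum>k\<le>n. w j k * aff k i) 0)"
      proof (rule sum.cong[OF refl])
        fix j assume j: "j \<in> {..<m}"
        have "(\<Sum>k\<le>n. v (Some (j, k)) * \<psi> S (Some (j, k)) i)
            = W1 j * (if i \<in> S j then (\<Sum>k\<le>n. w j k * aff k i) else 0)"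
          by (simp add: v_def \<psi>_def sum_distrib_left mult.assoc)
        also have "(if i \<in> S j then (\<Sum>k\<le>n. w j k * aff k i) else 0) = max (\<Sum>k\<le>n. w j k * aff k i) 0"
          using i j by (auto simp: S_def max_def)
        finally show "(\<Sum>k\<le>n. v (Some (j, k)) * \<psi> S (Some (j, k)) i)
            = W1 j * max (\<Sum>k\<le>n. w j k * aff k i) 0" .
      qed
      finally show ?thesis unfolding pre by linarith
    qed
    then have "P = {i\<in>I. (\<Sum>p\<in>K. v p * \<psi> S p i) > 0}"
      unfolding P by blast
    then have "P \<in> linear_patterns I K (\<psi> S)"
      using linear_patternsI by metis
    then show "P \<in> (\<Union>S\<in>PiE {..<m} (\<lambda>_. U). linear_patterns I K (\<psi> S))"
      using S by blast
  qed
  have finU: "finite U" unfolding U_def by (rule finlin)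
  then have finPi: "finite (PiE {..<m} (\<lambda>_. U))" by (simp add: finite_PiE)
  have finUN: "finite (\<Union>S\<in>PiE {..<m} (\<lambda>_. U). linear_patterns I K (\<psi> S))"
    using finPi finlin by blast
  show "finite (patterns (H1 n m) x M)"
    using sub finUN finite_subset by blast
  have "card U \<le> (M + 1) ^ (n + 1)"
    using card_linear_patterns_le[of "{..n}" I aff] fin by (simp add: U_def)
  then have cardPi: "card (PiE {..<m} (\<lambda>_. U)) \<le> ((M + 1) ^ (n + 1)) ^ m"
    by (simp add: card_PiE power_mono)
  have "card (patterns (H1 n m) x M) \<le> card (\<Union>S\<in>PiE {..<m} (\<lambda>_. U). linear_patterns I K (\<psi> S))"
    by (rule card_mono[OF finUN sub])
  also have "\<dots> \<le> (\<Sum>S\<in>PiE {..<m} (\<lambda>_. U). card (linear_patterns I K (\<psi> S)))"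
    by (rule card_UN_le[OF finPi])
  also have "\<dots> \<le> (\<Sum>S\<in>PiE {..<m} (\<lambda>_. U). (M + 1) ^ card K)"
    by (rule sum_mono) (metis card_linear_patterns_le fin)
  also have "\<dots> \<le> ((M + 1) ^ (n + 1)) ^ m * (M + 1) ^ card K"
    using cardPi by simp
  \<comment> \<open>The exponent adds \<open>m * (n + 1)\<close> for the activation patterns of the
    hidden units to \<open>m * (n + 1) + 1\<close> for the output.\<close>
  also have "\<dots> = (M + 1) ^ (2 * m * (n + 1) + 1)"
    by (simp only: cardK power_mult[symmetric] power_add[symmetric]) (rule arg_cong[where f = "power (M + 1)"], simp add: algebra_simps)
  finally show "card (patterns (H1 n m) x M) \<le> (M + 1) ^ (2 * m * (n + 1) + 1)" .
qed

section \<open>Uniform deviations by symmetrization\<close>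

text \<open>This is Hoeffding's lemma for a fair sign, taken from its auxiliary inequality with
  range \<open>2 * x\<close> and probability 1/2. That inequality is applied for a nonnegative
  range, and symmetry in \<open>x\<close> gives the rest.\<close>

lemma exp_plus_exp_minus_le: "exp x + exp (- x) \<le> 2 * exp (x\<^sup>2 / 2)" for x :: real
proof -
  have nonneg: "exp x + exp (- x) \<le> 2 * exp (x\<^sup>2 / 2)" if "x \<ge> 0" for x :: real
  proof -
    have pos: "1 + 1 / 2 * (exp (2 * x) - 1) > 0"
      using exp_gt_zero[of "2 * x"] by (simp add: field_simps add_pos_pos)
    have "- (2 * x) * (1 / 2) + ln (1 + 1 / 2 * (exp (2 * x) - 1)) \<le> (2 * x)\<^sup>2 / 8"
      using Hoeffdings_lemma_aux[of "2 * x" "1/2"] that by simp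
    then have "ln (1 + 1 / 2 * (exp (2 * x) - 1)) \<le> x + x\<^sup>2 / 2"
      by (simp add: power2_eq_square)
    then have "1 + 1 / 2 * (exp (2 * x) - 1) \<le> exp (x + x\<^sup>2 / 2)"
      using pos by (metis exp_le_cancel_iff exp_ln)
    then have "exp (- x) * (1 + exp (2 * x)) \<le> exp (- x) * (2 * exp (x + x\<^sup>2 / 2))"
      by (intro mult_left_mono) (auto simp: field_simps)
    then show ?thesis
      by (simp add: ring_distribs mult_exp_exp algebra_simps)
  qed
  show ?thesis
    using nonneg[of x] nonneg[of "- x"] by (cases "x \<ge> 0") auto
qed

text \<open>The moment generating function of a Rademacher sum, not divided by the number of sign
  choices: the sum over all signs factorises over the coordinates.\<close>

lemma sum_sign_patterns_exp_le:
  fixes c :: "'i \<Rightarrow> real"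
  assumes "finite I" "\<And>i. i \<in> I \<Longrightarrow> \<bar>c i\<bar> \<le> e"
  shows "(\<Sum>B\<in>Pow I. exp (\<Sum>i\<in>I. if i \<in> B then - c i else c i)) \<le> (2 * exp (e\<^sup>2 / 2)) ^ card I"
proof -
  have "exp (\<Sum>i\<in>I. if i \<in> B then - c i else c i)
      = (\<Prod>i\<in>B. exp (- c i)) * (\<Prod>i\<in>I - B. exp (c i))" if "B \<in> Pow I" for B
  proof -
    have "exp (\<Sum>i\<in>I. if i \<in> B then - c i else c i) = (\<Prod>i\<in>I. exp (if i \<in> B then - c i else c i))"
      by (rule exp_sum[OF assms(1)])
    also have "\<dots> = (\<Prod>i\<in>I - B. exp (if i \<in> B then - c i else c i)) * (\<Prod>i\<in>B. exp (if i \<in> B then - c i else c i))"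
      using that assms(1) by (intro prod.subset_diff) auto
    also have "\<dots> = (\<Prod>i\<in>I - B. exp (c i)) * (\<Prod>i\<in>B. exp (- c i))"
      by (intro arg_cong2[where f = "(*)"] prod.cong) auto
    finally show ?thesis by (simp add: mult.commute)
  qed
  then have "(\<Sum>B\<in>Pow I. exp (\<Sum>i\<in>I. if i \<in> B then - c i else c i))
      = (\<Prod>i\<in>I. exp (- c i) + exp (c i))"
    using assms(1) by (simp add: prod_add)
  also have "\<dots> \<le> (\<Prod>i\<in>I. 2 * exp (e\<^sup>2 / 2))"
  proof (intro prod_mono conjI)
    fix i assume i: "i \<in> I"
    have "(c i)\<^sup>2 \<le> e\<^sup>2" using assms(2)[OF i] by (metis abs_ge_zero power2_abs power_mono)
    then have "exp ((c i)\<^sup>2 / 2) \<le> exp (e\<^sup>2 / 2)" by simp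
    then show "exp (- c i) + exp (c i) \<le> 2 * exp (e\<^sup>2 / 2)"
      using exp_plus_exp_minus_le[of "c i"] by linarith
  qed (simp add: add_nonneg_nonneg)
  finally show ?thesis by simp
qed

section \<open>Ghost sample and random swaps\<close>

definition swap_idx :: "nat \<Rightarrow> nat set \<Rightarrow> nat \<Rightarrow> nat" where
  "swap_idx N B i = (if i \<in> B then i + N else if i \<ge> N \<and> i - N \<in> B then i - N else i)"

lemma swap_idx_invol: "B \<subseteq> {..<N} \<Longrightarrow> swap_idx N B (swap_idx N B i) = i"
  by (auto simp: swap_idx_def)

lemma swap_idx_less: "B \<subseteq> {..<N} \<Longrightarrow> i < 2 * N \<Longrightarrow> swap_idx N B i < 2 * N"
  by (auto simp: swap_idx_def)

text \<open>Positions below \<open>N\<close> hold the sample and the next \<open>N\<close> the ghost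
  sample, which is why growth is counted on \<open>2 * N\<close> points. Enumerating the class by
  \<open>nat\<close> makes its deviation events measurable; the size of the class enters the bounds
  only through \<open>S\<close>.\<close>

locale vc_class = prob_space M for M :: "'a measure" +
  fixes A :: "nat \<Rightarrow> 'a set" and N S :: nat and e :: real
  assumes sets_A [measurable]: "\<And>k. A k \<in> sets M"
    and N_pos: "N > 0" and e_pos: "e > 0"
    and growth: "\<And>z :: nat \<Rightarrow> 'a. card (range (\<lambda>k. {i\<in>{..<2*N}. z i \<in> A k})) \<le> S"
begin

abbreviation "P1 \<equiv> PiM {..<N} (\<lambda>_. M)"
abbreviation "P2 \<equiv> PiM {N..<2*N} (\<lambda>_. M)"
abbreviation "P \<equiv> PiM {..<2*N} (\<lambda>_. M)"

sublocale P1: prob_space P1 by (rule prob_space_PiM) (rule prob_space_axioms)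
sublocale P2: prob_space P2 by (rule prob_space_PiM) (rule prob_space_axioms)
sublocale P: prob_space P by (rule prob_space_PiM) (rule prob_space_axioms)

definition gap :: "nat \<Rightarrow> (nat \<Rightarrow> 'a) \<Rightarrow> real" where
  "gap k \<omega> = (\<Sum>i<N. indicat_real (A k) (\<omega> (i + N)) - indicat_real (A k) (\<omega> i))"

text \<open>With finitely many sets the maximum is attained, measurable and bounded. None of the
  resulting bounds involves \<open>K\<close>, so it can be sent to infinity at the end.\<close>

definition max_gap :: "nat \<Rightarrow> (nat \<Rightarrow> 'a) \<Rightarrow> real" where
  "max_gap K \<omega> = Max ((\<lambda>k. exp (e * gap k \<omega>)) ` {..K})"

lemma measurable_gap [measurable]: "gap k \<in> borel_measurable P"
  unfolding gap_def by measurable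

lemma measurable_max_gap [measurable]: "max_gap K \<in> borel_measurable P"
  unfolding max_gap_def by measurable

lemma abs_gap_le: "\<bar>gap k \<omega>\<bar> \<le> N"
proof -
  have "\<bar>gap k \<omega>\<bar> \<le> (\<Sum>i<N. 1)"
    unfolding gap_def by (intro order.trans[OF sum_abs] sum_mono) (auto simp: indicator_def)
  then show ?thesis by simp
qed

lemma exp_gap_le: "exp (e * gap k \<omega>) \<le> exp (e * N)"
  using abs_gap_le[of k \<omega>] e_pos by simp

lemma exp_gap_le_max_gap: "k \<le> K \<Longrightarrow> exp (e * gap k \<omega>) \<le> max_gap K \<omega>"
  unfolding max_gap_def by (rule Max_ge) auto

lemma max_gap_le: "max_gap K \<omega> \<le> exp (e * N)"
  unfolding max_gap_def by (subst Max_le_iff) (auto simp: exp_gap_le[simplified])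

lemma max_gap_attained: "\<exists>k\<le>K. max_gap K \<omega> = exp (e * gap k \<omega>)"
proof -
  have "max_gap K \<omega> \<in> (\<lambda>k. exp (e * gap k \<omega>)) ` {..K}"
    unfolding max_gap_def by (rule Max_in) auto
  then show ?thesis by blast
qed

lemma norm_max_gap_le: "norm (max_gap K \<omega>) \<le> exp (e * N)"
proof -
  have "max_gap K \<omega> > 0" using max_gap_attained[of K \<omega>] by auto
  then show ?thesis using max_gap_le[of K \<omega>] by simp
qed

lemma integrable_max_gap: "integrable P (max_gap K)"
  by (rule P.integrable_const_bound[of _ "exp (e * N)"]) (auto intro!: norm_max_gap_le[simplified])

lemma gap_swap:
  assumes "B \<subseteq> {..<N}"
  shows "gap k (\<lambda>i\<in>{..<2*N}. \<omega> (swap_idx N B i)) =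
    (\<Sum>i<N. if i \<in> B then - (indicat_real (A k) (\<omega> (i + N)) - indicat_real (A k) (\<omega> i))
       else indicat_real (A k) (\<omega> (i + N)) - indicat_real (A k) (\<omega> i))"
  unfolding gap_def using assms by (intro sum.cong) (auto simp: swap_idx_def)

lemma integral_max_gap_swap:
  assumes B: "B \<subseteq> {..<N}"
  shows "(\<integral>\<omega>. max_gap K (\<lambda>i\<in>{..<2*N}. \<omega> (swap_idx N B i)) \<partial>P) = (\<integral>\<omega>. max_gap K \<omega> \<partial>P)"
    and "integrable P (\<lambda>\<omega>. max_gap K (\<lambda>i\<in>{..<2*N}. \<omega> (swap_idx N B i)))"
proof -
  have inj: "inj_on (swap_idx N B) {..<2*N}"
    by (metis B inj_onI swap_idx_invol)
  have idx: "swap_idx N B \<in> {..<2*N} \<rightarrow> {..<2*N}"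
    using swap_idx_less[OF B] by auto
  have [measurable]: "(\<lambda>\<omega>. \<lambda>i\<in>{..<2*N}. \<omega> (swap_idx N B i)) \<in> P \<rightarrow>\<^sub>M P"
    using idx by (intro measurable_restrict measurable_component_singleton) auto
  have "distr P P (\<lambda>\<omega>. \<lambda>i\<in>{..<2*N}. \<omega> (swap_idx N B i)) = P"
    using distr_PiM_reindex[of "{..<2*N}" "\<lambda>_. M" "swap_idx N B" "{..<2*N}"] inj idx prob_space_axioms
    by simp
  then have "(\<integral>\<omega>. max_gap K \<omega> \<partial>P)
      = (\<integral>\<omega>. max_gap K \<omega> \<partial>(distr P P (\<lambda>\<omega>. \<lambda>i\<in>{..<2*N}. \<omega> (swap_idx N B i))))" by simp
  also have "\<dots> = (\<integral>\<omega>. max_gap K (\<lambda>i\<in>{..<2*N}. \<omega> (swap_idx N B i)) \<partial>P)"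
    by (rule integral_distr) measurable
  finally show "(\<integral>\<omega>. max_gap K (\<lambda>i\<in>{..<2*N}. \<omega> (swap_idx N B i)) \<partial>P) = (\<integral>\<omega>. max_gap K \<omega> \<partial>P)" ..
  show "integrable P (\<lambda>\<omega>. max_gap K (\<lambda>i\<in>{..<2*N}. \<omega> (swap_idx N B i)))"
    by (rule P.integrable_const_bound[of _ "exp (e * N)"]) (auto intro!: norm_max_gap_le[simplified])
qed

text \<open>With the double sample held fixed, the maximum over \<open>k\<close> is dominated by a
  sum over at most \<open>S\<close> patterns; here \<open>K\<close> disappears. For one pattern,
  swapping along \<open>B\<close> reverses the signs of the terms in \<open>B\<close>, so summing
  over \<open>B\<close> gives a Rademacher sum with coefficients in \<open>-e\<close>, 0 and
  \<open>e\<close>.\<close>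

lemma sum_max_gap_swap_le:
  "(\<Sum>B\<in>Pow {..<N}. max_gap K (\<lambda>i\<in>{..<2*N}. \<omega> (swap_idx N B i))) \<le> S * (2 * exp (e\<^sup>2 / 2)) ^ N"
proof -
  define R where "R = range (\<lambda>k. {i\<in>{..<2*N}. \<omega> i \<in> A k})"
  define c where "c p i = e * (indicat_real p (i + N) - indicat_real p i)" for p :: "nat set" and i
  have finR: "finite R"
    unfolding R_def by (rule finite_subset[of _ "Pow {..<2*N}"]) auto
  have "max_gap K (\<lambda>i\<in>{..<2*N}. \<omega> (swap_idx N B i))
      \<le> (\<Sum>p\<in>R. exp (\<Sum>i<N. if i \<in> B then - c p i else c p i))" if "B \<in> Pow {..<N}" for B
  proof -
    obtain k where k: "max_gap K (\<lambda>i\<in>{..<2*N}. \<omega> (swap_idx N B i)) = exp (e * gap k (\<lambda>i\<in>{..<2*N}. \<omega> (swap_idx N B i)))"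
      using max_gap_attained by blast
    define p where "p = {i\<in>{..<2*N}. \<omega> i \<in> A k}"
    have p: "p \<in> R" by (auto simp: R_def p_def)
    have ind: "indicat_real (A k) (\<omega> i) = indicat_real p i" if "i < 2 * N" for i
      using that by (auto simp: p_def indicator_def)
    have "e * gap k (\<lambda>i\<in>{..<2*N}. \<omega> (swap_idx N B i)) = (\<Sum>i<N. if i \<in> B then - c p i else c p i)"
      unfolding sum_distrib_left using that
      by (subst gap_swap) (auto simp: sum_distrib_left c_def ind algebra_simps intro!: sum.cong)
    then have "max_gap K (\<lambda>i\<in>{..<2*N}. \<omega> (swap_idx N B i)) = exp (\<Sum>i<N. if i \<in> B then - c p i else c p i)"
      using k by simp
    also have "\<dots> \<le> (\<Sum>p\<in>R. exp (\<Sum>i<N. if i \<in> B then - c p i else c p i))"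
      using member_le_sum[OF p, of "\<lambda>p. exp (\<Sum>i<N. if i \<in> B then - c p i else c p i)"] finR by simp
    finally show ?thesis .
  qed
  then have "(\<Sum>B\<in>Pow {..<N}. max_gap K (\<lambda>i\<in>{..<2*N}. \<omega> (swap_idx N B i)))
      \<le> (\<Sum>B\<in>Pow {..<N}. \<Sum>p\<in>R. exp (\<Sum>i<N. if i \<in> B then - c p i else c p i))"
    by (rule sum_mono)
  also have "\<dots> = (\<Sum>p\<in>R. \<Sum>B\<in>Pow {..<N}. exp (\<Sum>i<N. if i \<in> B then - c p i else c p i))"
    by (rule sum.swap)
  also have "\<dots> \<le> (\<Sum>p\<in>R. (2 * exp (e\<^sup>2 / 2)) ^ N)"
  proof (rule sum_mono)
    fix p
    show "(\<Sum>B\<in>Pow {..<N}. exp (\<Sum>i<N. if i \<in> B then - c p i else c p i)) \<le> (2 * exp (e\<^sup>2 / 2)) ^ N"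
      using sum_sign_patterns_exp_le[of "{..<N}" "c p" e] e_pos
      by (auto simp: c_def indicator_def)
  qed
  also have "\<dots> \<le> S * (2 * exp (e\<^sup>2 / 2)) ^ N"
    using growth[of \<omega>] by (simp add: R_def mult_right_mono)
  finally show ?thesis .
qed

text \<open>The double sample is i.i.d., so each swap preserves its law and the integral equals its
  average over all \<open>2 ^ N\<close> swaps.\<close>

lemma integral_max_gap_le: "(\<integral>\<omega>. max_gap K \<omega> \<partial>P) \<le> S * exp (N * e\<^sup>2 / 2)"
proof -
  have "2 ^ N * (\<integral>\<omega>. max_gap K \<omega> \<partial>P)
      = (\<Sum>B\<in>Pow {..<N}. (\<integral>\<omega>. max_gap K (\<lambda>i\<in>{..<2*N}. \<omega> (swap_idx N B i)) \<partial>P))"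
    by (simp add: integral_max_gap_swap(1) card_Pow)
  also have "\<dots> = (\<integral>\<omega>. (\<Sum>B\<in>Pow {..<N}. max_gap K (\<lambda>i\<in>{..<2*N}. \<omega> (swap_idx N B i))) \<partial>P)"
    by (rule Bochner_Integration.integral_sum[symmetric]) (simp add: integral_max_gap_swap(2))
  also have "\<dots> \<le> (\<integral>\<omega>. S * (2 * exp (e\<^sup>2 / 2)) ^ N \<partial>P)"
    by (rule integral_mono[OF _ _ sum_max_gap_swap_le])
       (auto intro!: Bochner_Integration.integrable_sum integral_max_gap_swap(2))
  also have "\<dots> = 2 ^ N * (S * exp (N * e\<^sup>2 / 2))"
    by (simp add: P.prob_space power_mult_distrib flip: exp_of_nat_mult)
  finally show ?thesis by simp
qed

text \<open>Averaging the gap over the ghost sample gives \<open>N\<close> times the deviation of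
  the fixed sample \<open>D\<close>. Jensen moves the average outside the exponential; bounding the
  single term by the maximum then removes \<open>k\<close> from the right side.\<close>

lemma deviation_le_ghost:
  assumes D: "D \<in> space P1" and k: "k \<le> K"
  shows "exp (e * (N * prob (A k) - (\<Sum>i<N. indicat_real (A k) (D i))))
      \<le> (\<integral>y. max_gap K (merge {..<N} {N..<2*N} (D, y)) \<partial>P2)"
proof -
  have Un: "{..<N} \<union> {N..<2*N} = {..<2*N}" by auto
  have mrg [measurable]: "(\<lambda>y. merge {..<N} {N..<2*N} (D, y)) \<in> P2 \<rightarrow>\<^sub>M P"
    using D measurable_merge[of "{..<N}" "{N..<2*N}" "\<lambda>_. M"] unfolding Un by measurable
  define X where "X y = gap k (merge {..<N} {N..<2*N} (D, y))" for y
  have [measurable]: "X \<in> borel_measurable P2"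
    unfolding X_def by measurable
  have X_eq: "X y = (\<Sum>i<N. indicat_real (A k) (y (i + N))) - (\<Sum>i<N. indicat_real (A k) (D i))" for y
    by (simp add: X_def gap_def merge_def sum_subtractf)
  have int1: "integrable P2 (\<lambda>y. indicat_real (A k) (y (i + N)))" if "i < N" for i
    using that by (intro P2.integrable_const_bound[of _ 1]) auto
  have comp: "(\<integral>y. indicat_real (A k) (y (i + N)) \<partial>P2) = prob (A k)" if "i < N" for i
  proof -
    have "(\<integral>y. indicat_real (A k) (y (i + N)) \<partial>P2) = (\<integral>a. indicat_real (A k) a \<partial>distr P2 M (\<lambda>y. y (i + N)))"
      using that by (subst integral_distr) auto
    also have "distr P2 M (\<lambda>y. y (i + N)) = M"
      using that prob_space_axioms by (intro distr_PiM_component[of "{N..<2*N}" "\<lambda>_. M"]) auto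
    finally show ?thesis by simp
  qed
  have EX: "P2.expectation X = N * prob (A k) - (\<Sum>i<N. indicat_real (A k) (D i))"
    unfolding X_eq
    by (subst Bochner_Integration.integral_diff)
       (auto simp: int1 comp Bochner_Integration.integral_sum P2.prob_space)
  have "exp (e * P2.expectation X) \<le> P2.expectation (\<lambda>y. exp (e * X y))"
  proof (rule P2.jensens_inequality[where I = UNIV and q = "\<lambda>x. exp (e * x)"])
    show "integrable P2 X"
      by (rule P2.integrable_const_bound[of _ N]) (auto simp: X_def intro!: abs_gap_le)
    show "integrable P2 (\<lambda>y. exp (e * X y))"
      by (rule P2.integrable_const_bound[of _ "exp (e * N)"]) (auto simp: X_def intro!: exp_gap_le[simplified])
    show "convex_on UNIV (\<lambda>x. exp (e * x))"
      using e_pos by (intro convex_on_exp) simp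
  qed auto
  also have "\<dots> \<le> (\<integral>y. max_gap K (merge {..<N} {N..<2*N} (D, y)) \<partial>P2)"
  proof (rule integral_mono)
    show "integrable P2 (\<lambda>y. exp (e * X y))"
      by (rule P2.integrable_const_bound[of _ "exp (e * N)"]) (auto simp: X_def intro!: exp_gap_le[simplified])
    show "integrable P2 (\<lambda>y. max_gap K (merge {..<N} {N..<2*N} (D, y)))"
      by (rule P2.integrable_const_bound[of _ "exp (e * N)"]) (auto intro!: norm_max_gap_le[simplified])
  qed (simp add: X_def exp_gap_le_max_gap[OF k])
  finally show ?thesis unfolding EX .
qed

definition dev :: "nat \<Rightarrow> (nat \<Rightarrow> 'a) \<Rightarrow> real" where
  "dev k D = prob (A k) - (\<Sum>i<N. indicat_real (A k) (D i)) / N"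

lemma measurable_dev [measurable]: "dev k \<in> borel_measurable P1"
  unfolding dev_def by measurable

text \<open>Markov's inequality for the ghost average \<open>g\<close>: on the event it is at least
  \<open>exp (N * e\<^sup>2)\<close>, while Fubini identifies its mean with the symmetrized
  integral.\<close>

lemma finite_deviation:
  "P1.prob {D \<in> space P1. \<exists>k\<le>K. dev k D > e} \<le> S * exp (- real N * e\<^sup>2 / 2)"
proof -
  have Un: "{..<N} \<union> {N..<2*N} = {..<2*N}" by auto
  interpret prod: product_sigma_finite "\<lambda>_ :: nat. M" by unfold_locales
  let ?E = "{D \<in> space P1. \<exists>k\<le>K. dev k D > e}"
  define g where "g D = (\<integral>y. max_gap K (merge {..<N} {N..<2*N} (D, y)) \<partial>P2)" for D
  have mrg [measurable]: "merge {..<N} {N..<2*N} \<in> P1 \<Otimes>\<^sub>M P2 \<rightarrow>\<^sub>M P"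
    using measurable_merge[of "{..<N}" "{N..<2*N}" "\<lambda>_. M"] unfolding Un .
  have meas: "(\<lambda>D. g D) \<in> borel_measurable P1"
    unfolding g_def by measurable
  have E [measurable]: "?E \<in> sets P1" by measurable
  have bnd: "g D \<ge> 0" "g D \<le> exp (e * N)" if "D \<in> space P1" for D
  proof -
    have "max_gap K \<omega> \<ge> 0" for \<omega> using max_gap_attained[of K \<omega>] by auto
    then show "g D \<ge> 0" unfolding g_def by simp
    have [measurable]: "(\<lambda>y. merge {..<N} {N..<2*N} (D, y)) \<in> P2 \<rightarrow>\<^sub>M P"
      using that by measurable
    have "g D \<le> (\<integral>y. exp (e * N) \<partial>P2)"
      unfolding g_def
      by (rule integral_mono)
         (auto intro!: max_gap_le[simplified] P2.integrable_const_bound[of _ "exp (e * N)"] norm_max_gap_le[simplified])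
    then show "g D \<le> exp (e * N)" by (simp add: P2.prob_space)
  qed
  have int_g: "integrable P1 g"
    by (rule P1.integrable_const_bound[of _ "exp (e * N)"]) (auto simp: meas bnd)
  have "P1.prob ?E = (\<integral>D. indicat_real ?E D \<partial>P1)" by simp
  also have "\<dots> \<le> (\<integral>D. exp (- real N * e\<^sup>2) * g D \<partial>P1)"
  proof (rule integral_mono)
    fix D assume D: "D \<in> space P1"
    show "indicat_real ?E D \<le> exp (- real N * e\<^sup>2) * g D"
    proof (cases "D \<in> ?E")
      case True
      then obtain k where k: "k \<le> K" "dev k D > e" by auto
      then have "N * prob (A k) - (\<Sum>i<N. indicat_real (A k) (D i)) \<ge> N * e"
        using N_pos by (simp add: dev_def field_simps)
      then have "e * (N * e) \<le> e * (N * prob (A k) - (\<Sum>i<N. indicat_real (A k) (D i)))"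
        using e_pos by (intro mult_left_mono) auto
      then have "exp (N * e\<^sup>2) \<le> exp (e * (N * prob (A k) - (\<Sum>i<N. indicat_real (A k) (D i))))"
        by (simp add: power2_eq_square algebra_simps)
      also have "\<dots> \<le> g D" unfolding g_def by (rule deviation_le_ghost[OF D k(1)])
      finally have "exp (- real N * e\<^sup>2) * exp (N * e\<^sup>2) \<le> exp (- real N * e\<^sup>2) * g D"
        by (intro mult_left_mono) auto
      then show ?thesis using True by (simp add: mult_exp_exp)
    qed (use bnd[OF D] in simp)
  qed (use int_g in \<open>auto intro!: integrable_real_indicator E simp: less_top[symmetric]\<close>)
  also have "\<dots> = exp (- real N * e\<^sup>2) * (\<integral>\<omega>. max_gap K \<omega> \<partial>P)"
    using prod.product_integral_fold[of "{..<N}" "{N..<2*N}" "max_gap K"] integrable_max_gap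
    unfolding Un g_def by (simp add: ivl_disj_int_one)
  also have "\<dots> \<le> exp (- real N * e\<^sup>2) * (S * exp (N * e\<^sup>2 / 2))"
    by (intro mult_left_mono integral_max_gap_le) auto
  also have "\<dots> = S * exp (- real N * e\<^sup>2 / 2)"
    by (simp add: mult_exp_exp algebra_simps)
  finally show ?thesis .
qed

lemma uniform_deviation:
  "P1.prob {D \<in> space P1. \<exists>k. dev k D > e} \<le> S * exp (- real N * e\<^sup>2 / 2)"
proof (rule LIMSEQ_le_const2)
  define E where "E K = {D \<in> space P1. \<exists>k\<le>K. dev k D > e}" for K
  have "(\<lambda>K. P1.prob (E K)) \<longlonglongrightarrow> P1.prob (\<Union>K. E K)"
  proof (rule P1.finite_Lim_measure_incseq)
    show "range E \<subseteq> sets P1" unfolding E_def by (auto; measurable)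
    show "incseq E" unfolding E_def incseq_def by (auto intro: order_trans)
  qed
  moreover have "(\<Union>K. E K) = {D \<in> space P1. \<exists>k. dev k D > e}"
    by (auto simp: E_def)
  ultimately show "(\<lambda>K. P1.prob (E K)) \<longlonglongrightarrow> P1.prob {D \<in> space P1. \<exists>k. dev k D > e}" by simp
  show "\<exists>K0. \<forall>K\<ge>K0. P1.prob (E K) \<le> S * exp (- real N * e\<^sup>2 / 2)"
    using finite_deviation by (auto simp: E_def)
qed

end

section \<open>Rational networks are dense\<close>

definition net :: "nat \<Rightarrow> nat \<Rightarrow> (nat \<times> nat \<Rightarrow> real) \<Rightarrow> (nat \<Rightarrow> real) \<Rightarrow> (nat \<Rightarrow> real) \<Rightarrow> (nat \<Rightarrow> real) \<Rightarrow> real" where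
  "net n m W0 b W1 x = (\<Sum>j<m. W1 j * max ((\<Sum>i\<in>{1..n}. W0 (j, i) * x i) - b j) 0)"

lemma H1_eq_net: "H1 n m = {h. \<exists>W0 b W1 lam. lam > 0 \<and> h = (\<lambda>x. net n m W0 b W1 x > lam)}"
proof (intro set_eqI iffI)
  fix h assume "h \<in> H1 n m"
  then obtain W0 b W1 lam where "lam > 0"
    "h = (\<lambda>x. (\<Sum>j<m. W1 j * max ((\<Sum>i\<in>{1..n}. W0 j i * x i) - b j) 0) > (lam::real))"
    unfolding H1_def by blast
  then have "lam > 0 \<and> h = (\<lambda>x. net n m (case_prod W0) b W1 x > lam)"
    by (simp add: net_def)
  then show "h \<in> {h. \<exists>W0 b W1 lam. lam > 0 \<and> h = (\<lambda>x. net n m W0 b W1 x > lam)}" by blast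
next
  fix h assume "h \<in> {h. \<exists>W0 b W1 lam. lam > 0 \<and> h = (\<lambda>x. net n m W0 b W1 x > lam)}"
  then obtain W0 b W1 lam where "lam > 0" "h = (\<lambda>x. net n m W0 b W1 x > lam)" by blast
  then show "h \<in> H1 n m"
    unfolding H1_def net_def by (auto intro!: exI[of _ "\<lambda>j i. W0 (j, i)"])
qed

lemma measurable_net [measurable]: "net n m W0 b W1 \<in> borel_measurable (PiM {1..n} (\<lambda>_. lborel))"
  unfolding net_def by measurable

lemma measurable_H1:
  assumes "h \<in> H1 n m"
  shows "h \<in> PiM {1..n} (\<lambda>_. lborel) \<rightarrow>\<^sub>M count_space UNIV"
proof -
  obtain W0 b W1 lam where h: "h = (\<lambda>x. net n m W0 b W1 x > lam)"
    using assms unfolding H1_eq_net by blast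
  show ?thesis unfolding h by measurable
qed

text \<open>Weights are fixed outside their finite index sets, since rational sequences alone would
  form an uncountable parameter set. Having the inner weights uncurried in \<open>net\<close> lets a
  single \<open>PiE\<close> describe them.\<close>

definition H1_rat :: "nat \<Rightarrow> nat \<Rightarrow> ((nat \<Rightarrow> real) \<Rightarrow> bool) set" where
  "H1_rat n m = (\<lambda>(W0, b, W1, lam) x. net n m W0 b W1 x > lam) `
     (PiE ({..<m} \<times> {1..n}) (\<lambda>_. \<rat>) \<times> PiE {..<m} (\<lambda>_. \<rat>) \<times> PiE {..<m} (\<lambda>_. \<rat>) \<times> (\<rat> \<inter> {0<..}))"

lemma countable_H1_rat: "countable (H1_rat n m)"
  unfolding H1_rat_def by (intro countable_image countable_SIGMA countable_PiE countable_Int1 countable_rat) auto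

lemma H1_rat_subset: "H1_rat n m \<subseteq> H1 n m"
  unfolding H1_rat_def H1_eq_net by auto

text \<open>A limit with an explicit rate: bare convergence could not be compared with a threshold
  shift that itself tends to 0. The notion is stable under all operations inside a network, so it
  passes from the weights to the output.\<close>

definition quad_close :: "(nat \<Rightarrow> real) \<Rightarrow> real \<Rightarrow> bool" where
  "quad_close f a \<longleftrightarrow> (\<exists>C. \<forall>k. \<bar>f k - a\<bar> \<le> C / (real k + 1)\<^sup>2)"

lemma quad_closeE:
  assumes "quad_close f a"
  obtains C where "C \<ge> 0" "\<And>k. \<bar>f k - a\<bar> \<le> C / (real k + 1)\<^sup>2"
proof -
  obtain C where C: "\<And>k. \<bar>f k - a\<bar> \<le> C / (real k + 1)\<^sup>2"
    using assms unfolding quad_close_def by blast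
  have "0 \<le> C" using C[of 0] by simp
  then show ?thesis using C that by blast
qed

lemma quad_close_const: "quad_close (\<lambda>_. a) a"
  unfolding quad_close_def by (intro exI[of _ 0]) simp

lemma quad_close_add:
  assumes "quad_close f a" "quad_close g b"
  shows "quad_close (\<lambda>k. f k + g k) (a + b)"
proof -
  obtain C D where "\<And>k. \<bar>f k - a\<bar> \<le> C / (real k + 1)\<^sup>2" "\<And>k. \<bar>g k - b\<bar> \<le> D / (real k + 1)\<^sup>2"
    using assms by (meson quad_closeE)
  then have "\<bar>f k + g k - (a + b)\<bar> \<le> (C + D) / (real k + 1)\<^sup>2" for k
    unfolding add_divide_distrib
    by (smt (verit))
  then show ?thesis unfolding quad_close_def by blast
qed

lemma quad_close_mult:
  assumes "quad_close f a" "quad_close g b"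
  shows "quad_close (\<lambda>k. f k * g k) (a * b)"
proof -
  obtain C D where C: "C \<ge> 0" "\<And>k. \<bar>f k - a\<bar> \<le> C / (real k + 1)\<^sup>2"
    and D: "D \<ge> 0" "\<And>k. \<bar>g k - b\<bar> \<le> D / (real k + 1)\<^sup>2"
    using assms by (meson quad_closeE)
  have "\<bar>f k * g k - a * b\<bar> \<le> (C * (\<bar>b\<bar> + D) + \<bar>a\<bar> * D) / (real k + 1)\<^sup>2" for k
  proof -
    have "(real k + 1)\<^sup>2 \<ge> 1" by simp
    then have "D / (real k + 1)\<^sup>2 \<le> D" using D(1) by (simp add: divide_le_eq mult_left_le mult_le_cancel_left1)
    then have g: "\<bar>g k\<bar> \<le> \<bar>b\<bar> + D" using D(2)[of k] by linarith
    have "f k * g k - a * b = (f k - a) * g k + a * (g k - b)" by (simp add: algebra_simps)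
    then have "\<bar>f k * g k - a * b\<bar> \<le> \<bar>f k - a\<bar> * \<bar>g k\<bar> + \<bar>a\<bar> * \<bar>g k - b\<bar>"
      by (metis abs_mult abs_triangle_ineq)
    also have "\<dots> \<le> C / (real k + 1)\<^sup>2 * (\<bar>b\<bar> + D) + \<bar>a\<bar> * (D / (real k + 1)\<^sup>2)"
      using C D g by (intro add_mono mult_mono) auto
    also have "\<dots> = (C * (\<bar>b\<bar> + D) + \<bar>a\<bar> * D) / (real k + 1)\<^sup>2"
      by (simp add: add_divide_distrib)
    finally show ?thesis .
  qed
  then show ?thesis unfolding quad_close_def by blast
qed

lemma quad_close_diff:
  assumes "quad_close f a" "quad_close g b"
  shows "quad_close (\<lambda>k. f k - g k) (a - b)"
  using quad_close_add[OF assms(1) quad_close_mult[OF quad_close_const[of "-1"] assms(2)]] by simp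

lemma quad_close_max:
  assumes "quad_close f a"
  shows "quad_close (\<lambda>k. max (f k) 0) (max a 0)"
proof -
  obtain C where C: "\<And>k. \<bar>f k - a\<bar> \<le> C / (real k + 1)\<^sup>2"
    using assms unfolding quad_close_def by blast
  have "\<bar>max (f k) 0 - max a 0\<bar> \<le> \<bar>f k - a\<bar>" for k by linarith
  then show ?thesis unfolding quad_close_def using C order_trans by blast
qed

lemma quad_close_sum:
  assumes "finite I" "\<And>i. i \<in> I \<Longrightarrow> quad_close (\<lambda>k. f k i) (a i)"
  shows "quad_close (\<lambda>k. \<Sum>i\<in>I. f k i) (\<Sum>i\<in>I. a i)"
  using assms by (induction I rule: finite_induct) (simp_all add: quad_close_const quad_close_add)

definition rat_approx :: "nat \<Rightarrow> real \<Rightarrow> real" where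
  "rat_approx k c = of_int \<lfloor>c * (real k + 1)\<^sup>2\<rfloor> / (real k + 1)\<^sup>2"

lemma rat_approx_Rats: "rat_approx k c \<in> \<rat>"
  unfolding rat_approx_def by auto

text \<open>Rounding down to the grid does not make a nonnegative number negative, so the raised
  rational threshold is positive, as membership in the class demands.\<close>

lemma rat_approx_nonneg: "c \<ge> 0 \<Longrightarrow> rat_approx k c \<ge> 0"
  unfolding rat_approx_def by simp

lemma quad_close_rat_approx: "quad_close (\<lambda>k. rat_approx k c) c"
proof -
  have "\<bar>rat_approx k c - c\<bar> \<le> 1 / (real k + 1)\<^sup>2" for k
  proof -
    have "(real k + 1)\<^sup>2 > 0" by simp
    moreover have "\<bar>of_int \<lfloor>c * (real k + 1)\<^sup>2\<rfloor> - c * (real k + 1)\<^sup>2\<bar> \<le> 1" by linarith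
    moreover have "rat_approx k c - c = (of_int \<lfloor>c * (real k + 1)\<^sup>2\<rfloor> - c * (real k + 1)\<^sup>2) / (real k + 1)\<^sup>2"
      by (simp add: rat_approx_def diff_divide_distrib)
    ultimately show ?thesis by (simp add: divide_right_mono)
  qed
  then show ?thesis unfolding quad_close_def by blast
qed

text \<open>The threshold is raised by \<open>1 / (k + 1)\<close>, which dominates the quadratically small error of the
  network output, so that inputs lying exactly on the decision boundary keep their label.\<close>

lemma H1_rat_dense:
  assumes "h \<in> H1 n m"
  obtains hk where "\<And>k. hk k \<in> H1_rat n m" "\<And>x. \<forall>\<^sub>F k in sequentially. hk k x = h x"
proof -
  obtain W0 b W1 lam where lam: "lam > 0" and h: "h = (\<lambda>x. net n m W0 b W1 x > lam)"
    using assms unfolding H1_eq_net by blast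
  define V0 where "V0 k = (\<lambda>p\<in>{..<m} \<times> {1..n}. rat_approx k (W0 p))" for k
  define c where "c k = (\<lambda>j\<in>{..<m}. rat_approx k (b j))" for k
  define V1 where "V1 k = (\<lambda>j\<in>{..<m}. rat_approx k (W1 j))" for k
  define mu where "mu k = rat_approx k lam + 1 / (real k + 1)" for k
  define hk where "hk k = (\<lambda>x. net n m (V0 k) (c k) (V1 k) x > mu k)" for k
  have "mu k \<in> \<rat> \<inter> {0<..}" for k
    using rat_approx_nonneg[of lam k] lam
    by (auto simp: mu_def intro!: Rats_add Rats_divide rat_approx_Rats add_nonneg_pos)
  then have "hk k \<in> H1_rat n m" for k
    unfolding H1_rat_def hk_def
    by (intro image_eqI[of _ _ "(V0 k, c k, V1 k, mu k)"])
       (auto simp: V0_def c_def V1_def rat_approx_Rats)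
  moreover have "\<forall>\<^sub>F k in sequentially. hk k x = h x" for x
  proof -
    have "quad_close (\<lambda>k. net n m (V0 k) (c k) (V1 k) x) (net n m W0 b W1 x)"
      unfolding net_def V0_def c_def V1_def
      by (intro quad_close_sum quad_close_mult quad_close_max quad_close_diff)
         (auto simp: quad_close_rat_approx quad_close_const)
    then have "quad_close (\<lambda>k. net n m (V0 k) (c k) (V1 k) x - rat_approx k lam) (net n m W0 b W1 x - lam)"
      by (intro quad_close_diff quad_close_rat_approx)
    then obtain C where C: "C \<ge> 0" "\<And>k. \<bar>(net n m (V0 k) (c k) (V1 k) x - rat_approx k lam) - (net n m W0 b W1 x - lam)\<bar>
        \<le> C / (real k + 1)\<^sup>2" by (elim quad_closeE) blast
    define u where "u k = net n m (V0 k) (c k) (V1 k) x - rat_approx k lam" for k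
    define v where "v = net n m W0 b W1 x - lam"
    have uv: "\<bar>u k - v\<bar> \<le> C / (real k + 1)\<^sup>2" for k using C(2) by (simp add: u_def v_def)
    have hk: "hk k x \<longleftrightarrow> u k > 1 / (real k + 1)" for k by (auto simp: hk_def u_def mu_def)
    have hx: "h x \<longleftrightarrow> v > 0" by (auto simp: h v_def)
    show ?thesis
    proof (cases "v > 0")
      case True
      have "(\<lambda>k. C / (real k + 1)\<^sup>2 + 1 / (real k + 1)) \<longlonglongrightarrow> 0" by real_asymp
      then have "\<forall>\<^sub>F k in sequentially. C / (real k + 1)\<^sup>2 + 1 / (real k + 1) < v"
        using True by (rule order_tendstoD)
      then show ?thesis
      proof eventually_elim
        case (elim k)
        then show ?case using uv[of k] True by (simp add: hk hx)
      qed
    next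
      case False
      have "\<forall>\<^sub>F k in sequentially. C / (real k + 1)\<^sup>2 \<le> 1 / (real k + 1)" by real_asymp
      then show ?thesis
      proof eventually_elim
        case (elim k)
        then show ?case using uv[of k] False by (simp add: hk hx)
      qed
    qed
  qed
  ultimately show ?thesis using that by blast
qed

section \<open>Gaussian tails and the law of the data\<close>

text \<open>The factor one half is needed: a union bound over \<open>2 n - 2\<close> tails must stay below \<open>n\<close> times
  the exponential.\<close>

lemma std_normal_upper_tail:
  assumes "t \<ge> 0"
  shows "(\<integral>\<^sup>+x. ennreal (std_normal_density x) * indicator {t<..} x \<partial>lborel) \<le> ennreal (exp (- t\<^sup>2 / 2) / 2)"
proof -
  let ?pos = "\<integral>\<^sup>+x. ennreal (std_normal_density x) * indicator {0<..} x \<partial>lborel"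
  let ?neg = "\<integral>\<^sup>+x. ennreal (std_normal_density x) * indicator {..<0} x \<partial>lborel"
  have sym: "?neg = ?pos"
    by (subst nn_integral_real_affine[where c = "-1" and t = 0])
       (auto simp: std_normal_density_def indicator_def intro!: nn_integral_cong)
  have "?pos + ?neg = (\<integral>\<^sup>+x. ennreal (std_normal_density x) * indicator {0<..} x
      + ennreal (std_normal_density x) * indicator {..<0} x \<partial>lborel)"
    by (rule nn_integral_add[symmetric]) auto
  also have "\<dots> \<le> (\<integral>\<^sup>+x. ennreal (std_normal_density x) \<partial>lborel)"
    by (rule nn_integral_mono) (auto simp: indicator_def)
  also have "\<dots> = 1"
    by (subst nn_integral_eq_integral) auto
  finally have "2 * ?pos \<le> 1" by (simp add: sym mult_2)
  then have half: "?pos \<le> ennreal (1 / 2)"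
  proof (cases ?pos)
    case (real r)
    then have "ennreal (2 * r) \<le> ennreal 1"
      using \<open>2 * ?pos \<le> 1\<close> by (simp add: ennreal_mult')
    then show ?thesis using real by (simp del: ennreal_1 ennreal_half add: ennreal_leI)
  next
    case top
    then show ?thesis using \<open>2 * ?pos \<le> 1\<close> by (simp add: top_unique)
  qed
  have "(\<integral>\<^sup>+x. ennreal (std_normal_density x) * indicator {t<..} x \<partial>lborel)
      = (\<integral>\<^sup>+x. ennreal (std_normal_density (t + x)) * indicator {t<..} (t + x) \<partial>lborel)"
    by (subst nn_integral_real_affine[where c = 1 and t = t]) auto
  also have "\<dots> \<le> (\<integral>\<^sup>+x. ennreal (exp (- t\<^sup>2 / 2)) * (ennreal (std_normal_density x) * indicator {0<..} x) \<partial>lborel)"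
  proof (rule nn_integral_mono)
    fix x :: real
    \<comment> \<open>After translation by \<open>t\<close>, dropping the cross term
      \<open>2 * t * x \<ge> 0\<close> extracts the exponential factor and leaves a half line of
      mass one half.\<close>
    have "std_normal_density (t + x) \<le> exp (- t\<^sup>2 / 2) * std_normal_density x" if "x > 0"
    proof -
      have "(t + x)\<^sup>2 \<ge> t\<^sup>2 + x\<^sup>2" using that assms by (simp add: power2_sum)
      then have "exp (- (t + x)\<^sup>2 / 2) \<le> exp (- t\<^sup>2 / 2 + - x\<^sup>2 / 2)" by simp
      then have "1 / sqrt (2 * pi) * exp (- (t + x)\<^sup>2 / 2)
          \<le> 1 / sqrt (2 * pi) * (exp (- t\<^sup>2 / 2) * exp (- x\<^sup>2 / 2))"
        unfolding exp_add by (rule mult_left_mono) simp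
      then show ?thesis by (simp add: std_normal_density_def)
    qed
    then show "ennreal (std_normal_density (t + x)) * indicator {t<..} (t + x)
        \<le> ennreal (exp (- t\<^sup>2 / 2)) * (ennreal (std_normal_density x) * indicator {0<..} x)"
      by (auto simp: indicator_def simp flip: ennreal_mult'')
  qed
  also have "\<dots> = ennreal (exp (- t\<^sup>2 / 2)) * ?pos"
    by (rule nn_integral_cmult) simp
  also have "\<dots> \<le> ennreal (exp (- t\<^sup>2 / 2)) * ennreal (1 / 2)"
    by (intro mult_left_mono half) simp
  also have "\<dots> = ennreal (exp (- t\<^sup>2 / 2) / 2)"
    by (subst ennreal_mult'[symmetric]) simp_all
  finally show ?thesis .
qed

lemma (in prob_space) normal_upper_tail:
  assumes X: "distributed M lborel X (normal_density \<mu> 1)" and t: "t \<ge> 0"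
  shows "prob {x\<in>space M. X x > \<mu> + t} \<le> exp (- t\<^sup>2 / 2) / 2"
proof -
  have Z: "distributed M lborel (\<lambda>x. X x - \<mu>) std_normal_density"
    using X normal_standard_normal_convert[of 1 X \<mu>] by simp
  have "emeasure M {x\<in>space M. X x > \<mu> + t} = emeasure M ((\<lambda>x. X x - \<mu>) -` {t<..} \<inter> space M)"
    by (rule arg_cong[where f = "emeasure M"]) auto
  also have "\<dots> = (\<integral>\<^sup>+x. ennreal (std_normal_density x) * indicator {t<..} x \<partial>lborel)"
    by (rule distributed_emeasure[OF Z]) simp
  also have "\<dots> \<le> ennreal (exp (- t\<^sup>2 / 2) / 2)"
    by (rule std_normal_upper_tail[OF t])
  finally show ?thesis
    by (simp add: emeasure_eq_measure)
qed

section \<open>Linear statistics of the observation vector\<close>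

lemma sets_CP [measurable_cong]: "sets (CP n \<tau> a b) = sets (PiM {1..n} (\<lambda>_. lborel))"
  unfolding CP_def by (rule sets_PiM_cong) auto

lemma space_CP: "space (CP n \<tau> a b) = space (PiM {1..n} (\<lambda>_. lborel))"
  by (rule sets_eq_imp_space_eq[OF sets_CP])

lemma prob_space_CP: "prob_space (CP n \<tau> a b)"
  unfolding CP_def by (intro prob_space_PiM prob_space_normal_density) simp

text \<open>The coordinates are independent normals, so the sum is normal. Adding independent
  normals asks for positive standard deviations \<open>\<bar>c i\<bar>\<close>, hence the
  nonvanishing coefficients; the CUSUM contrasts have them.\<close>

lemma CP_linear_form:
  assumes n: "n > 0" and c: "\<And>i. i \<in> {1..n} \<Longrightarrow> c i \<noteq> 0"
  shows "distributed (CP n \<tau> a b) lborel (\<lambda>x. \<Sum>i\<in>{1..n}. c i * x i)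
    (normal_density (\<Sum>i\<in>{1..n}. c i * mean_vec n \<tau> a b i) (sqrt (\<Sum>i\<in>{1..n}. (c i)\<^sup>2)))"
proof -
  let ?N = "\<lambda>i. density lborel (normal_density (mean_vec n \<tau> a b i) 1)"
  interpret prob_space "CP n \<tau> a b" by (rule prob_space_CP)
  have N: "prob_space (?N i)" for i by (rule prob_space_normal_density) simp
  have comp: "distr (CP n \<tau> a b) borel (\<lambda>x. x i) = ?N i" if "i \<in> {1..n}" for i
  proof -
    have "distr (CP n \<tau> a b) borel (\<lambda>x. x i) = distr (CP n \<tau> a b) (?N i) (\<lambda>x. x i)"
      by (rule distr_cong) simp_all
    also have "\<dots> = ?N i"
      unfolding CP_def by (rule distr_PiM_component[OF N that])
    finally show ?thesis .
  qed
  have meas: "(\<lambda>x. x i) \<in> borel_measurable (CP n \<tau> a b)" if "i \<in> {1..n}" for i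
    using that unfolding measurable_cong_sets[OF sets_CP refl] by measurable
  have "indep_vars (\<lambda>_. borel) (\<lambda>i x. x i) {1..n}"
  proof (subst indep_vars_iff_distr_eq_PiM')
    have "distr (CP n \<tau> a b) (PiM {1..n} (\<lambda>i. borel)) (\<lambda>x. \<lambda>i\<in>{1..n}. x i)
        = distr (CP n \<tau> a b) (CP n \<tau> a b) (\<lambda>x. x)"
    proof (rule distr_cong)
      show "sets (PiM {1..n} (\<lambda>i. borel)) = sets (CP n \<tau> a b)"
        unfolding sets_CP by (rule sets_PiM_cong) auto
    qed (auto simp: space_CP space_PiM PiE_def extensional_restrict)
    also have "\<dots> = PiM {1..n} (\<lambda>i. distr (CP n \<tau> a b) borel (\<lambda>x. x i))"
      unfolding distr_id by (subst CP_def) (rule PiM_cong, simp_all add: comp)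
    finally show "distr (CP n \<tau> a b) (PiM {1..n} (\<lambda>i. borel)) (\<lambda>x. \<lambda>i\<in>{1..n}. x i)
        = PiM {1..n} (\<lambda>i. distr (CP n \<tau> a b) borel (\<lambda>x. x i))" .
  qed (use n meas in auto)
  then have ind: "indep_vars (\<lambda>_. borel) (\<lambda>i x. c i * x i) {1..n}"
    by (rule indep_vars_compose2) auto
  have "distributed (CP n \<tau> a b) lborel (\<lambda>x. c i * x i) (normal_density (c i * mean_vec n \<tau> a b i) \<bar>c i\<bar>)"
    if i: "i \<in> {1..n}" for i
  proof -
    have "distributed (CP n \<tau> a b) lborel (\<lambda>x. x i) (normal_density (mean_vec n \<tau> a b i) 1)"
      unfolding distributed_def using comp[OF i] meas[OF i] by (auto cong: distr_cong)
    then show ?thesis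
      using normal_density_affine[of "\<lambda>x. x i" "mean_vec n \<tau> a b i" 1 "c i" 0] c[OF i] by simp
  qed
  then show ?thesis
    using sum_indep_normal[OF _ _ ind, of "\<lambda>i. \<bar>c i\<bar>" "\<lambda>i. c i * mean_vec n \<tau> a b i"] n c by auto
qed

lemma CP_linear_tail:
  assumes n: "n > 0" and c: "\<And>i. i \<in> {1..n} \<Longrightarrow> c i \<noteq> 0" "(\<Sum>i\<in>{1..n}. (c i)\<^sup>2) = 1" and t: "t \<ge> 0"
  shows "measure (CP n \<tau> a b) {x\<in>space (CP n \<tau> a b).
      (\<Sum>i\<in>{1..n}. c i * x i) > (\<Sum>i\<in>{1..n}. c i * mean_vec n \<tau> a b i) + t} \<le> exp (- t\<^sup>2 / 2) / 2"
proof (rule prob_space.normal_upper_tail[OF prob_space_CP _ t])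
  show "distributed (CP n \<tau> a b) lborel (\<lambda>x. \<Sum>i\<in>{1..n}. c i * x i)
      (normal_density (\<Sum>i\<in>{1..n}. c i * mean_vec n \<tau> a b i) 1)"
    using CP_linear_form[of n c \<tau> a b] n c(1) unfolding c(2) by simp
qed

section \<open>Measurability of the data law in the parameter\<close>

definition std_noise :: "nat \<Rightarrow> (nat \<Rightarrow> real) measure" where
  "std_noise n = PiM {1..n} (\<lambda>_. density lborel std_normal_density)"

definition shift :: "nat \<Rightarrow> nat \<Rightarrow> real \<Rightarrow> real \<Rightarrow> (nat \<Rightarrow> real) \<Rightarrow> nat \<Rightarrow> real" where
  "shift n \<tau> a b z = (\<lambda>i\<in>{1..n}. mean_vec n \<tau> a b i + z i)"

lemma sets_std_noise [measurable_cong]: "sets (std_noise n) = sets (PiM {1..n} (\<lambda>_. lborel))"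
  unfolding std_noise_def by (rule sets_PiM_cong) auto

lemma prob_space_std_noise: "prob_space (std_noise n)"
  unfolding std_noise_def by (intro prob_space_PiM prob_space_normal_density) simp

lemma vimage_plus_borel: "A \<in> sets borel \<Longrightarrow> (+) m -` A \<in> sets borel" for m :: real
  using measurable_sets[of "\<lambda>z. m + z" borel borel A] by simp

lemma density_normal_translate:
  "density lborel (normal_density m 1) = distr (density lborel std_normal_density) lborel (\<lambda>z. m + z)"
proof (rule measure_eqI)
  fix A :: "real set" assume "A \<in> sets (density lborel (normal_density m 1))"
  then have A [measurable]: "A \<in> sets borel" by simp
  have "emeasure (density lborel (normal_density m 1)) A = (\<integral>\<^sup>+x. ennreal (normal_density m 1 x) * indicator A x \<partial>lborel)"
    by (rule emeasure_density) auto
  also have "\<dots> = (\<integral>\<^sup>+x. ennreal (normal_density m 1 (m + x)) * indicator A (m + x) \<partial>lborel)"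
    by (subst nn_integral_real_affine[where c = 1 and t = m]) auto
  also have "\<dots> = (\<integral>\<^sup>+x. ennreal (std_normal_density x) * indicator ((\<lambda>z. m + z) -` A \<inter> space lborel) x \<partial>lborel)"
    by (rule nn_integral_cong) (simp add: normal_density_def indicator_def)
  also have "\<dots> = emeasure (density lborel std_normal_density) ((\<lambda>z. m + z) -` A \<inter> space lborel)"
    by (rule emeasure_density[symmetric]) (auto intro!: vimage_plus_borel A)
  also have "\<dots> = emeasure (distr (density lborel std_normal_density) lborel (\<lambda>z. m + z)) A"
    by (subst emeasure_distr) auto
  finally show "emeasure (density lborel (normal_density m 1)) A
      = emeasure (distr (density lborel std_normal_density) lborel (\<lambda>z. m + z)) A" .
qed simp

lemma measurable_shift [measurable]: "shift n \<tau> a b \<in> std_noise n \<rightarrow>\<^sub>M PiM {1..n} (\<lambda>_. lborel)"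
  unfolding shift_def measurable_cong_sets[OF sets_std_noise refl] by measurable

text \<open>All laws become images of one noise measure, so dependence on the parameter sits in a
  map instead of a measure. It suffices to compare both sides on boxes, where each factor is a
  translated Gaussian.\<close>

lemma CP_eq_distr: "CP n \<tau> a b = distr (std_noise n) (PiM {1..n} (\<lambda>_. lborel)) (shift n \<tau> a b)"
proof -
  let ?N = "\<lambda>i. density lborel (normal_density (mean_vec n \<tau> a b i) 1)"
  let ?Z = "density lborel std_normal_density"
  interpret N: product_prob_space ?N "{1..n}"
    by (intro product_prob_spaceI prob_space_normal_density) simp
  interpret Z: product_prob_space "\<lambda>_. ?Z" "{1..n}"
    by (intro product_prob_spaceI prob_space_normal_density) simp
  have "distr (std_noise n) (PiM {1..n} (\<lambda>_. lborel)) (shift n \<tau> a b) = PiM {1..n} ?N"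
  proof (rule N.PiM_eqI)
    show "sets (distr (std_noise n) (PiM {1..n} (\<lambda>_. lborel)) (shift n \<tau> a b)) = sets (PiM {1..n} ?N)"
      unfolding sets_distr by (rule sets_PiM_cong) auto
    fix A :: "nat \<Rightarrow> real set" assume A: "\<And>i. i \<in> {1..n} \<Longrightarrow> A i \<in> sets (?N i)"
    let ?B = "\<lambda>i. (\<lambda>z. mean_vec n \<tau> a b i + z) -` A i \<inter> space lborel"
    have AP: "PiE {1..n} A \<in> sets (PiM {1..n} (\<lambda>_. lborel))"
      using A by (intro sets_PiM_I_finite) auto
    have "emeasure (distr (std_noise n) (PiM {1..n} (\<lambda>_. lborel)) (shift n \<tau> a b)) (PiE {1..n} A)
        = emeasure (std_noise n) (shift n \<tau> a b -` PiE {1..n} A \<inter> space (std_noise n))"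
      by (rule emeasure_distr[OF measurable_shift AP])
    also have "shift n \<tau> a b -` PiE {1..n} A \<inter> space (std_noise n) = PiE {1..n} ?B"
      by (auto simp: shift_def std_noise_def space_PiM PiE_iff)
    also have "emeasure (std_noise n) (PiE {1..n} ?B) = (\<Prod>i\<in>{1..n}. emeasure ?Z (?B i))"
      unfolding std_noise_def using A
      by (intro Z.emeasure_PiM) (auto intro!: vimage_plus_borel)
    also have "\<dots> = (\<Prod>i\<in>{1..n}. emeasure (?N i) (A i))"
    proof (rule prod.cong[OF refl])
      fix i assume "i \<in> {1..n}"
      then have "A i \<in> sets borel" using A by simp
      then show "emeasure ?Z (?B i) = emeasure (?N i) (A i)"
        unfolding density_normal_translate[of "mean_vec n \<tau> a b i"] by (subst emeasure_distr) auto
    qed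
    finally show "emeasure (distr (std_noise n) (PiM {1..n} (\<lambda>_. lborel)) (shift n \<tau> a b)) (PiE {1..n} A)
        = (\<Prod>i\<in>{1..n}. emeasure (?N i) (A i))" .
  qed simp
  then show ?thesis unfolding CP_def ..
qed

definition kern :: "nat \<Rightarrow> nat \<times> real \<times> real \<Rightarrow> ((nat \<Rightarrow> real) \<times> bool) measure" where
  "kern n = (\<lambda>(\<tau>, muL, muR). distr (CP n \<tau> muL muR) (data_space n) (\<lambda>x. (x, muL \<noteq> muR)))"

lemma XY_law_eq: "XY_law n \<pi> = \<pi> \<bind> kern n"
  unfolding XY_law_def kern_def ..

lemma measurable_label [measurable]:
  "(\<lambda>x. (x, l)) \<in> CP n \<tau> a b \<rightarrow>\<^sub>M data_space n"
  unfolding data_space_def measurable_cong_sets[OF sets_CP refl] by measurable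

lemma prob_space_kern: "prob_space (kern n \<theta>)"
  unfolding kern_def by (cases \<theta>) (auto intro!: prob_space.prob_space_distr prob_space_CP)

lemma sets_kern [simp]: "sets (kern n \<theta>) = sets (data_space n)"
  unfolding kern_def by (cases \<theta>) auto

text \<open>This is what allows the bind in \<open>XY_law\<close> to be evaluated as a mixture over
  the prior. As the noise law does not vary with the parameter, joint measurability of
  \<open>g\<close> is enough.\<close>

lemma measurable_kern:
  "kern n \<in> count_space UNIV \<Otimes>\<^sub>M borel \<Otimes>\<^sub>M borel \<rightarrow>\<^sub>M subprob_algebra (data_space n)"
proof -
  let ?L = "count_space UNIV \<Otimes>\<^sub>M borel \<Otimes>\<^sub>M borel :: (nat \<times> real \<times> real) measure"
  define g where "g \<theta> z = (shift n (fst \<theta>) (fst (snd \<theta>)) (snd (snd \<theta>)) z, fst (snd \<theta>) \<noteq> snd (snd \<theta>))"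
    for \<theta> :: "nat \<times> real \<times> real" and z
  have eq: "kern n = (\<lambda>\<theta>. distr (std_noise n) (data_space n) (g \<theta>))"
  proof
    fix \<theta> :: "nat \<times> real \<times> real"
    obtain \<tau> a b where \<theta>: "\<theta> = (\<tau>, a, b)" by (cases \<theta>)
    have label: "(\<lambda>x. (x, a \<noteq> b)) \<in> PiM {1..n} (\<lambda>_. lborel) \<rightarrow>\<^sub>M data_space n"
      unfolding data_space_def by measurable
    have g_eq: "g \<theta> = (\<lambda>z. (shift n \<tau> a b z, a \<noteq> b))"
      by (simp add: fun_eq_iff g_def \<theta>)
    have "kern n \<theta> = distr (distr (std_noise n) (PiM {1..n} (\<lambda>_. lborel)) (shift n \<tau> a b)) (data_space n) (\<lambda>x. (x, a \<noteq> b))"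
      by (simp add: kern_def \<theta> CP_eq_distr)
    also have "\<dots> = distr (std_noise n) (data_space n) (g \<theta>)"
      by (subst distr_distr[OF label measurable_shift]) (simp add: g_eq comp_def)
    finally show "kern n \<theta> = distr (std_noise n) (data_space n) (g \<theta>)" .
  qed
  let ?LP = "?L \<Otimes>\<^sub>M PiM {1..n} (\<lambda>_. lborel) :: ((nat \<times> real \<times> real) \<times> (nat \<Rightarrow> real)) measure"
  have [measurable]: "(\<lambda>p. fst (fst p)) \<in> ?LP \<rightarrow>\<^sub>M count_space UNIV"
    "(\<lambda>p. fst (snd (fst p))) \<in> borel_measurable ?LP" "(\<lambda>p. snd (snd (fst p))) \<in> borel_measurable ?LP"
    by measurable
  have "(\<lambda>p. \<lambda>i\<in>{1..n}. mean_vec n (fst (fst p)) (fst (snd (fst p))) (snd (snd (fst p))) i + snd p i)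
      \<in> ?LP \<rightarrow>\<^sub>M PiM {1..n} (\<lambda>_. lborel)"
  proof (rule measurable_restrict)
    fix i assume i: "i \<in> {1..n}"
    have [measurable]: "(\<lambda>p. snd p i) \<in> borel_measurable ?LP"
      using i by measurable
    show "(\<lambda>p. mean_vec n (fst (fst p)) (fst (snd (fst p))) (snd (snd (fst p))) i + snd p i) \<in> ?LP \<rightarrow>\<^sub>M lborel"
      unfolding mean_vec_def measurable_lborel2 by measurable
  qed
  moreover have "(\<lambda>p. fst (snd (fst p)) \<noteq> snd (snd (fst p))) \<in> ?LP \<rightarrow>\<^sub>M count_space UNIV"
    by measurable
  ultimately have "case_prod g \<in> ?LP \<rightarrow>\<^sub>M data_space n"
    unfolding g_def data_space_def shift_def case_prod_beta by (rule measurable_Pair)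
  then have "case_prod g \<in> ?L \<Otimes>\<^sub>M std_noise n \<rightarrow>\<^sub>M data_space n"
    using measurable_cong_sets[OF sets_pair_measure_cong[OF refl sets_std_noise] refl] by blast
  moreover have "(\<lambda>_. std_noise n) \<in> ?L \<rightarrow>\<^sub>M subprob_algebra (std_noise n)"
    by (intro measurable_const) (simp add: space_subprob_algebra prob_space_imp_subprob_space prob_space_std_noise)
  ultimately show ?thesis
    unfolding eq by (intro measurable_distr2)
qed

lemma
  assumes "prob_space \<pi>" "sets \<pi> = sets (count_space UNIV \<Otimes>\<^sub>M borel \<Otimes>\<^sub>M borel)"
  shows prob_space_XY_law: "prob_space (XY_law n \<pi>)"
    and sets_XY_law: "sets (XY_law n \<pi>) = sets (data_space n)"
    and measure_XY_law_le: "\<And>A c. A \<in> sets (data_space n) \<Longrightarrow> c \<ge> 0 \<Longrightarrow>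
      AE \<theta> in \<pi>. measure (kern n \<theta>) A \<le> c \<Longrightarrow> measure (XY_law n \<pi>) A \<le> c"
proof -
  interpret prob_space \<pi> by fact
  have K: "kern n \<in> \<pi> \<rightarrow>\<^sub>M subprob_algebra (data_space n)"
    using measurable_kern measurable_cong_sets[OF assms(2) refl] by blast
  show P: "prob_space (XY_law n \<pi>)"
    unfolding XY_law_eq by (rule prob_space_bind[OF _ K]) (simp add: prob_space_kern)
  show "sets (XY_law n \<pi>) = sets (data_space n)"
    unfolding XY_law_eq by (rule sets_bind[OF sets_kern not_empty])
  fix A and c :: real
  assume A: "A \<in> sets (data_space n)" and c: "c \<ge> 0" and AE: "AE \<theta> in \<pi>. measure (kern n \<theta>) A \<le> c"
  interpret Q: prob_space "XY_law n \<pi>" by fact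
  have "emeasure (XY_law n \<pi>) A = (\<integral>\<^sup>+\<theta>. emeasure (kern n \<theta>) A \<partial>\<pi>)"
    unfolding XY_law_eq by (rule emeasure_bind[OF not_empty K A])
  also have "\<dots> \<le> (\<integral>\<^sup>+\<theta>. ennreal c \<partial>\<pi>)"
  proof (rule nn_integral_mono_AE)
    show "AE \<theta> in \<pi>. emeasure (kern n \<theta>) A \<le> ennreal c"
      using AE
    proof eventually_elim
      case (elim \<theta>)
      interpret k: prob_space "kern n \<theta>" by (rule prob_space_kern)
      show ?case unfolding k.emeasure_eq_measure using elim by (rule ennreal_leI)
    qed
  qed
  also have "\<dots> = ennreal c" by (simp add: emeasure_space_1)
  finally show "measure (XY_law n \<pi>) A \<le> c"
    using c by (simp add: Q.emeasure_eq_measure)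
qed

section \<open>The CUSUM network and the empirical risk minimiser\<close>

text \<open>The contrast between the means before and after \<open>t\<close>, scaled to unit
  Euclidean norm. Its noise is therefore standard normal, and at the true change point its mean is,
  in absolute value, \<open>sqrt n\<close> times the signal size in \<open>Theta\<close>.\<close>

definition cusum :: "nat \<Rightarrow> nat \<Rightarrow> nat \<Rightarrow> real" where
  "cusum n t i = sqrt (real t * real (n - t) / real n) * (if i \<le> t then 1 / real t else - 1 / real (n - t))"

lemma sum_split_at:
  assumes "t \<le> n"
  shows "(\<Sum>i\<in>{1..n}. if i \<le> t then p else q) = real t * p + real (n - t) * (q :: real)"
proof -
  have "{1..n} = {1..t} \<union> {t+1..n}" using assms by auto
  then have "(\<Sum>i\<in>{1..n}. if i \<le> t then p else q)
      = (\<Sum>i\<in>{1..t}. if i \<le> t then p else q) + (\<Sum>i\<in>{t+1..n}. if i \<le> t then p else q)"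
    by (simp add: sum.union_disjoint)
  also have "(\<Sum>i\<in>{1..t}. if i \<le> t then p else q) = (\<Sum>i\<in>{1..t}. p)" by (rule sum.cong) auto
  also have "(\<Sum>i\<in>{t+1..n}. if i \<le> t then p else q) = (\<Sum>i\<in>{t+1..n}. q)" by (rule sum.cong) auto
  finally show ?thesis using assms by simp
qed

context
  fixes n t :: nat
  assumes t: "1 \<le> t" "t < n"
begin

lemma cusum_nonzero: "cusum n t i \<noteq> 0"
  using t by (auto simp: cusum_def)

lemma sum_cusum_sq: "(\<Sum>i\<in>{1..n}. (cusum n t i)\<^sup>2) = 1"
proof -
  let ?s = "real t * real (n - t) / real n"
  have "(\<Sum>i\<in>{1..n}. (cusum n t i)\<^sup>2) = (\<Sum>i\<in>{1..n}. if i \<le> t then ?s * (1 / real t)\<^sup>2 else ?s * (1 / real (n - t))\<^sup>2)"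
    by (rule sum.cong) (auto simp: cusum_def power_mult_distrib power_divide)
  also have "\<dots> = real t * (?s * (1 / real t)\<^sup>2) + real (n - t) * (?s * (1 / real (n - t))\<^sup>2)"
    using t by (intro sum_split_at) simp
  also have "\<dots> = (real (n - t) + real t) / real n"
    using t by (simp add: power2_eq_square add_divide_distrib del: of_nat_diff)
  also have "real (n - t) + real t = real n" using t by simp
  also have "real n / real n = 1" using t by simp
  finally show ?thesis .
qed

lemma sum_cusum_mean: "(\<Sum>i\<in>{1..n}. cusum n t i * mean_vec n t a b i) = sqrt (real t * real (n - t) / real n) * (a - b)"
proof -
  let ?s = "sqrt (real t * real (n - t) / real n)"
  have "(\<Sum>i\<in>{1..n}. cusum n t i * mean_vec n t a b i) = (\<Sum>i\<in>{1..n}. if i \<le> t then ?s * a / real t else - ?s * b / real (n - t))"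
    by (rule sum.cong) (auto simp: cusum_def mean_vec_def)
  also have "\<dots> = real t * (?s * a / real t) + real (n - t) * (- ?s * b / real (n - t))"
    using t by (intro sum_split_at) simp
  also have "\<dots> = ?s * (a - b)" using t by (simp add: right_diff_distrib del: of_nat_diff)
  finally show ?thesis .
qed

lemma sum_cusum_const: "(\<Sum>i\<in>{1..n}. cusum n t i * mean_vec n \<tau> a a i) = 0"
  using sum_cusum_mean[of a a] by (simp add: mean_vec_def)

end

text \<open>A rectifier sees one tail only, so each of the \<open>n - 1\<close> split points
  occupies two consecutive units of opposite sign.\<close>

definition signed_cusum :: "nat \<Rightarrow> nat \<times> nat \<Rightarrow> real" where
  "signed_cusum n = (\<lambda>(j, i). (if even j then 1 else -1) * cusum n (j div 2 + 1) i)"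

text \<open>With outer weights 1 the output is a sum of nonnegative excesses over
  \<open>\<beta>\<close>: it vanishes unless some unit exceeds \<open>\<beta>\<close>, and it is at
  least as large as each single excess.\<close>

definition cusum_test :: "nat \<Rightarrow> real \<Rightarrow> real \<Rightarrow> (nat \<Rightarrow> real) \<Rightarrow> bool" where
  "cusum_test n \<beta> lam x \<longleftrightarrow> net n (2 * n - 2) (signed_cusum n) (\<lambda>_. \<beta>) (\<lambda>_. 1) x > lam"

lemma cusum_test_H1: "lam > 0 \<Longrightarrow> cusum_test n \<beta> lam \<in> H1 n (2 * n - 2)"
  unfolding H1_eq_net cusum_test_def by blast

lemma cusum_testD:
  assumes "cusum_test n \<beta> lam x" "lam > 0"
  shows "\<exists>j<2*n-2. (\<Sum>i\<in>{1..n}. signed_cusum n (j, i) * x i) > \<beta>"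
proof (rule ccontr)
  assume "\<not> ?thesis"
  then have "net n (2 * n - 2) (signed_cusum n) (\<lambda>_. \<beta>) (\<lambda>_. 1) x = 0"
    unfolding net_def by (intro sum.neutral) auto
  then show False using assms by (simp add: cusum_test_def)
qed

lemma not_cusum_testD:
  assumes "\<not> cusum_test n \<beta> lam x" "j < 2 * n - 2" "lam > 0"
  shows "(\<Sum>i\<in>{1..n}. signed_cusum n (j, i) * x i) \<le> \<beta> + lam"
proof -
  have "1 * max ((\<Sum>i\<in>{1..n}. signed_cusum n (j, i) * x i) - \<beta>) 0 \<le> net n (2 * n - 2) (signed_cusum n) (\<lambda>_. \<beta>) (\<lambda>_. 1) x"
    unfolding net_def using assms(2) by (intro member_le_sum) auto
  then show ?thesis using assms by (simp add: cusum_test_def)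
qed

lemma signed_cusum_tail:
  assumes j: "j < 2 * n - 2" and r: "r \<ge> 0"
  shows "measure (CP n \<tau> a b) {x\<in>space (CP n \<tau> a b). (\<Sum>i\<in>{1..n}. signed_cusum n (j, i) * x i)
      > (\<Sum>i\<in>{1..n}. signed_cusum n (j, i) * mean_vec n \<tau> a b i) + r} \<le> exp (- r\<^sup>2 / 2) / 2"
    and "measure (CP n \<tau> a b) {x\<in>space (CP n \<tau> a b). (\<Sum>i\<in>{1..n}. signed_cusum n (j, i) * x i)
      < (\<Sum>i\<in>{1..n}. signed_cusum n (j, i) * mean_vec n \<tau> a b i) - r} \<le> exp (- r\<^sup>2 / 2) / 2"
proof -
  have t: "1 \<le> j div 2 + 1" "j div 2 + 1 < n" using j by auto
  have n: "n > 0" using t by simp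
  have nz: "signed_cusum n (j, i) \<noteq> 0" for i
    using cusum_nonzero[OF t] by (simp add: signed_cusum_def)
  have sq: "(\<Sum>i\<in>{1..n}. (signed_cusum n (j, i))\<^sup>2) = 1"
    using sum_cusum_sq[OF t] by (simp add: signed_cusum_def power_mult_distrib cong: if_cong)
  show "measure (CP n \<tau> a b) {x\<in>space (CP n \<tau> a b). (\<Sum>i\<in>{1..n}. signed_cusum n (j, i) * x i)
      > (\<Sum>i\<in>{1..n}. signed_cusum n (j, i) * mean_vec n \<tau> a b i) + r} \<le> exp (- r\<^sup>2 / 2) / 2"
    by (rule CP_linear_tail[OF n nz sq r])
  have "measure (CP n \<tau> a b) {x\<in>space (CP n \<tau> a b). (\<Sum>i\<in>{1..n}. - signed_cusum n (j, i) * x i)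
      > (\<Sum>i\<in>{1..n}. - signed_cusum n (j, i) * mean_vec n \<tau> a b i) + r} \<le> exp (- r\<^sup>2 / 2) / 2"
    by (rule CP_linear_tail[OF n _ _ r]) (use nz sq in simp_all)
  then show "measure (CP n \<tau> a b) {x\<in>space (CP n \<tau> a b). (\<Sum>i\<in>{1..n}. signed_cusum n (j, i) * x i)
      < (\<Sum>i\<in>{1..n}. signed_cusum n (j, i) * mean_vec n \<tau> a b i) - r} \<le> exp (- r\<^sup>2 / 2) / 2"
    by (simp add: sum_negf minus_less_iff algebra_simps)
qed

lemma measurable_linear_form_CP [measurable]:
  "(\<lambda>x. \<Sum>i\<in>{1..n}. c i * x i) \<in> borel_measurable (CP n \<tau> a b)"
  unfolding measurable_cong_sets[OF sets_CP refl] by measurable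

text \<open>The output threshold \<open>lam\<close> must be positive; choosing it at most \<open>ln 2 / \<beta>\<close> costs a factor
  two in the type II error, which the factor one half in the Gaussian tail absorbs.\<close>

lemma cusum_test_error:
  assumes n: "n \<ge> 2" and \<theta>: "(\<tau>, a, b) \<in> Theta n B" and B: "B > 0"
    and \<beta>: "\<beta> = sqrt n * B / 2" and lam: "0 < lam" "lam \<le> \<beta>" "\<beta> * lam \<le> ln 2"
  shows "measure (CP n \<tau> a b) {x\<in>space (CP n \<tau> a b). cusum_test n \<beta> lam x \<noteq> (a \<noteq> b)}
    \<le> n * exp (- real n * B\<^sup>2 / 8)"
proof -
  interpret prob_space "CP n \<tau> a b" by (rule prob_space_CP)
  let ?l = "\<lambda>j x. \<Sum>i\<in>{1..n}. signed_cusum n (j, i) * x i"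
  have \<beta>sq: "\<beta>\<^sup>2 / 2 = n * B\<^sup>2 / 8" by (simp add: \<beta> power_mult_distrib power_divide)
  have \<beta>0: "\<beta> \<ge> 0" using B by (simp add: \<beta>)
  have \<tau>: "1 \<le> \<tau>" "\<tau> < n" using \<theta> n by (auto simp: Theta_def)
  have eqe: "exp (- \<beta>\<^sup>2 / 2) = exp (- real n * B\<^sup>2 / 8)" using \<beta>sq by simp
  show ?thesis
  proof (cases "a = b")
    case True
    have "prob {x\<in>space (CP n \<tau> a b). cusum_test n \<beta> lam x \<noteq> (a \<noteq> b)}
        \<le> prob (\<Union>j<2*n-2. {x\<in>space (CP n \<tau> a b). ?l j x > \<beta>})"
    proof (rule finite_measure_mono)
      show "{x\<in>space (CP n \<tau> a b). cusum_test n \<beta> lam x \<noteq> (a \<noteq> b)}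
          \<subseteq> (\<Union>j<2*n-2. {x\<in>space (CP n \<tau> a b). ?l j x > \<beta>})"
        using True cusum_testD[OF _ lam(1)] by fastforce
    qed measurable
    also have "\<dots> \<le> (\<Sum>j<2*n-2. prob {x\<in>space (CP n \<tau> a b). ?l j x > \<beta>})"
    proof (rule finite_measure_subadditive_finite)
      have "{x\<in>space (CP n \<tau> a b). ?l j x > \<beta>} \<in> events" for j by measurable
      then show "(\<lambda>j. {x\<in>space (CP n \<tau> a b). ?l j x > \<beta>}) ` {..<2*n-2} \<subseteq> events" by blast
    qed simp
    also have "\<dots> \<le> (\<Sum>j<2*n-2. exp (- \<beta>\<^sup>2 / 2) / 2)"
    proof (rule sum_mono)
      fix j assume "j \<in> {..<2*n-2}"
      then have j: "j < 2 * n - 2" by simp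
      have t: "1 \<le> j div 2 + 1" "j div 2 + 1 < n" using j by auto
      \<comment> \<open>A constant mean vector is orthogonal to every contrast, whichever split
        point the unit \<open>j\<close> looks at.\<close>
      have "?l j (mean_vec n \<tau> a b) = (if even j then 1 else -1) * (\<Sum>i\<in>{1..n}. cusum n (j div 2 + 1) i * mean_vec n \<tau> a a i)"
        unfolding sum_distrib_left by (rule sum.cong) (simp_all add: signed_cusum_def True)
      then have "?l j (mean_vec n \<tau> a b) = 0"
        using sum_cusum_const[OF t] by simp
      then show "prob {x\<in>space (CP n \<tau> a b). ?l j x > \<beta>} \<le> exp (- \<beta>\<^sup>2 / 2) / 2"
        using signed_cusum_tail(1)[OF j \<beta>0, of \<tau> a b] by simp
    qed
    also have "\<dots> = (n - 1) * exp (- \<beta>\<^sup>2 / 2)"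
      using n by (simp add: of_nat_diff field_simps)
    also have "\<dots> \<le> n * exp (- \<beta>\<^sup>2 / 2)" by (intro mult_right_mono) auto
    finally show ?thesis unfolding eqe .
  next
    case False
    \<comment> \<open>The unit that sits at the true change point and whose sign makes its mean
      positive.\<close>
    define j where "j = 2 * (\<tau> - 1) + (if a > b then 0 else 1)"
    have j: "j < 2 * n - 2" using \<tau> by (auto simp: j_def)
    have jt: "j div 2 + 1 = \<tau>" and ev: "even j \<longleftrightarrow> a > b" using \<tau> by (auto simp: j_def)
    have "?l j (mean_vec n \<tau> a b) = (if a > b then 1 else -1) * (\<Sum>i\<in>{1..n}. cusum n \<tau> i * mean_vec n \<tau> a b i)"
      unfolding sum_distrib_left by (rule sum.cong) (simp_all add: signed_cusum_def jt[simplified] ev)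
    also have "\<dots> = sqrt (real \<tau> * real (n - \<tau>) / real n) * \<bar>a - b\<bar>"
      using sum_cusum_mean[OF \<tau>] False by (auto simp: abs_if algebra_simps)
    finally have mean: "?l j (mean_vec n \<tau> a b) = sqrt (real \<tau> * real (n - \<tau>) / real n) * \<bar>a - b\<bar>" .
    have "\<bar>a - b\<bar> * sqrt (real \<tau> * real (n - \<tau>)) / real n > B"
      using \<theta> False \<tau> n by (auto simp: Theta_def Let_def)
    \<comment> \<open>Multiplying the separation condition by \<open>sqrt n\<close> puts the mean of
      this unit above \<open>2 * \<beta>\<close>, so \<open>\<beta>\<close> is at most half of it
      and a miss requires a downward deviation of more than \<open>\<beta> - lam\<close>.\<close>
    then have "sqrt n * B < sqrt n * (\<bar>a - b\<bar> * sqrt (real \<tau> * real (n - \<tau>)) / real n)"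
      by (rule mult_strict_left_mono) (use n in simp)
    also have "\<dots> = sqrt (real \<tau> * real (n - \<tau>) / real n) * \<bar>a - b\<bar>"
    proof -
      have "sqrt n * sqrt n = real n" by simp
      then have r: "sqrt n / n = 1 / sqrt n" using n by (simp add: field_simps)
      have "sqrt n * (\<bar>a - b\<bar> * sqrt (real \<tau> * real (n - \<tau>)) / real n)
          = sqrt n / n * (\<bar>a - b\<bar> * sqrt (real \<tau> * real (n - \<tau>)))" by simp
      then show ?thesis unfolding r by (simp add: real_sqrt_divide)
    qed
    finally have gap: "2 * \<beta> < ?l j (mean_vec n \<tau> a b)" unfolding mean \<beta> by simp
    have "prob {x\<in>space (CP n \<tau> a b). cusum_test n \<beta> lam x \<noteq> (a \<noteq> b)}
        \<le> prob {x\<in>space (CP n \<tau> a b). ?l j x < ?l j (mean_vec n \<tau> a b) - (\<beta> - lam)}"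
    proof (rule finite_measure_mono)
      show "{x\<in>space (CP n \<tau> a b). cusum_test n \<beta> lam x \<noteq> (a \<noteq> b)}
          \<subseteq> {x\<in>space (CP n \<tau> a b). ?l j x < ?l j (mean_vec n \<tau> a b) - (\<beta> - lam)}"
      proof
        fix x assume x: "x \<in> {x\<in>space (CP n \<tau> a b). cusum_test n \<beta> lam x \<noteq> (a \<noteq> b)}"
        then have "?l j x \<le> \<beta> + lam" using False not_cusum_testD[OF _ j lam(1)] by blast
        then have "?l j x < ?l j (mean_vec n \<tau> a b) - (\<beta> - lam)" using gap by linarith
        then show "x \<in> {x\<in>space (CP n \<tau> a b). ?l j x < ?l j (mean_vec n \<tau> a b) - (\<beta> - lam)}"
          using x by blast
      qed
    qed measurable
    also have "\<dots> \<le> exp (- (\<beta> - lam)\<^sup>2 / 2) / 2"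
      using lam by (intro signed_cusum_tail(2)[OF j]) simp
    also have "\<dots> \<le> exp (- \<beta>\<^sup>2 / 2)"
    proof -
      have "- (\<beta> - lam)\<^sup>2 / 2 \<le> - \<beta>\<^sup>2 / 2 + \<beta> * lam"
        by (simp add: power2_diff field_simps)
      also have "\<dots> \<le> - \<beta>\<^sup>2 / 2 + ln 2" using lam by simp
      finally have "exp (- (\<beta> - lam)\<^sup>2 / 2) \<le> exp (- \<beta>\<^sup>2 / 2 + ln 2)"
        unfolding exp_le_cancel_iff .
      then show ?thesis unfolding exp_add by simp
    qed
    also have "\<dots> \<le> n * exp (- \<beta>\<^sup>2 / 2)" using n by simp
    finally show ?thesis unfolding eqe .
  qed
qed

section \<open>Risk and empirical risk over the network class\<close>

lemma measurable_fst_snd_data [measurable]: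
  "fst \<in> data_space n \<rightarrow>\<^sub>M PiM {1..n} (\<lambda>_. lborel)" "snd \<in> data_space n \<rightarrow>\<^sub>M count_space UNIV"
  unfolding data_space_def by measurable

lemma sets_error:
  assumes "h \<in> PiM {1..n} (\<lambda>_. lborel) \<rightarrow>\<^sub>M count_space UNIV"
  shows "{p\<in>space (data_space n). h (fst p) \<noteq> snd p} \<in> sets (data_space n)"
proof -
  have [measurable]: "(\<lambda>p. h (fst p)) \<in> data_space n \<rightarrow>\<^sub>M count_space UNIV"
    using measurable_compose[OF measurable_fst_snd_data(1) assms] .
  show ?thesis by measurable
qed

lemma exists_low_risk:
  assumes n: "n \<ge> 2" and B: "B > 0"
    and \<pi>: "prob_space \<pi>" "sets \<pi> = sets (count_space UNIV \<Otimes>\<^sub>M borel \<Otimes>\<^sub>M borel)"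
    and AE: "AE \<theta> in \<pi>. \<theta> \<in> Theta n B"
  shows "\<exists>h\<in>H1 n (2 * n - 2). risk n \<pi> h \<le> n * exp (- real n * B\<^sup>2 / 8)"
proof -
  define \<beta> where "\<beta> = sqrt n * B / 2"
  have \<beta>: "\<beta> > 0" using n B by (simp add: \<beta>_def)
  \<comment> \<open>The first bound keeps the tail radius \<open>\<beta> - lam\<close> nonnegative,
    the second limits the loss of power.\<close>
  define lam where "lam = min \<beta> (ln 2 / \<beta>)"
  have lam: "0 < lam" "lam \<le> \<beta>" "\<beta> * lam \<le> ln 2"
    using \<beta> by (auto simp: lam_def min_def field_simps)
  let ?h = "cusum_test n \<beta> lam"
  have H: "?h \<in> H1 n (2 * n - 2)" by (rule cusum_test_H1[OF lam(1)])
  let ?A = "{p\<in>space (data_space n). ?h (fst p) \<noteq> snd p}"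
  have A: "?A \<in> sets (data_space n)" by (rule sets_error[OF measurable_H1[OF H]])
  have "measure (XY_law n \<pi>) ?A \<le> n * exp (- real n * B\<^sup>2 / 8)"
  proof (rule measure_XY_law_le[OF \<pi> A])
    show "AE \<theta> in \<pi>. measure (kern n \<theta>) ?A \<le> n * exp (- real n * B\<^sup>2 / 8)"
      using AE
    proof eventually_elim
      case (elim \<theta>)
      obtain \<tau> a b where \<theta>: "\<theta> = (\<tau>, a, b)" by (cases \<theta>)
      have "measure (kern n \<theta>) ?A = measure (CP n \<tau> a b) ((\<lambda>x. (x, a \<noteq> b)) -` ?A \<inter> space (CP n \<tau> a b))"
        unfolding \<theta> kern_def prod.case by (rule measure_distr[OF measurable_label A])
      also have "(\<lambda>x. (x, a \<noteq> b)) -` ?A \<inter> space (CP n \<tau> a b) = {x\<in>space (CP n \<tau> a b). ?h x \<noteq> (a \<noteq> b)}"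
        by (auto simp: data_space_def space_CP space_pair_measure)
      also have "measure (CP n \<tau> a b) \<dots> \<le> n * exp (- real n * B\<^sup>2 / 8)"
        using elim unfolding \<theta> by (rule cusum_test_error[OF n _ B \<beta>_def lam])
      finally show ?case .
    qed
  qed simp
  then have "risk n \<pi> ?h \<le> n * exp (- real n * B\<^sup>2 / 8)"
    unfolding risk_def sets_eq_imp_space_eq[OF sets_XY_law[OF \<pi>]] .
  then show ?thesis using H by blast
qed

text \<open>On a fixed sample the labels are fixed too, so an error pattern is a function of the
  classification pattern and the count cannot grow. Points outside \<open>X\<close> merely drop out
  of every pattern.\<close>

lemma card_error_patterns_le:
  assumes "range f \<subseteq> H1 n m"
  shows "card (range (\<lambda>k::nat. {i\<in>{..<M}. z i \<in> {p\<in>X. f k (fst p) \<noteq> snd p}})) \<le> (M + 1) ^ (2 * m * (n + 1) + 1)"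
proof -
  let ?x = "\<lambda>i. fst (z i)"
  define G where "G P = {i\<in>{..<M}. z i \<in> X \<and> (i \<in> P) \<noteq> snd (z i)}" for P
  have "range (\<lambda>k::nat. {i\<in>{..<M}. z i \<in> {p\<in>X. f k (fst p) \<noteq> snd p}}) \<subseteq> G ` patterns (H1 n m) ?x M"
  proof safe
    fix k
    have "{i\<in>{..<M}. f k (?x i)} \<in> patterns (H1 n m) ?x M"
      using assms unfolding patterns_def by blast
    moreover have "{i\<in>{..<M}. z i \<in> {p\<in>X. f k (fst p) \<noteq> snd p}} = G {i\<in>{..<M}. f k (?x i)}"
      unfolding G_def by auto
    ultimately show "{i\<in>{..<M}. z i \<in> {p\<in>X. f k (fst p) \<noteq> snd p}} \<in> G ` patterns (H1 n m) ?x M"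
      by blast
  qed
  then have "card (range (\<lambda>k::nat. {i\<in>{..<M}. z i \<in> {p\<in>X. f k (fst p) \<noteq> snd p}})) \<le> card (patterns (H1 n m) ?x M)"
    by (rule surj_card_le[OF card_patterns_H1_le(1)])
  also note card_patterns_H1_le(2)
  finally show ?thesis .
qed

text \<open>Eventual equality at every single input, the decision boundary included, makes the error
  indicators converge everywhere; dominated convergence with the constant 1 does the rest.\<close>

lemma risk_tendsto:
  assumes \<pi>: "prob_space \<pi>" "sets \<pi> = sets (count_space UNIV \<Otimes>\<^sub>M borel \<Otimes>\<^sub>M borel)"
    and h: "\<And>k. hk k \<in> H1 n m" "h \<in> H1 n m"
    and lim: "\<And>x. \<forall>\<^sub>F k in sequentially. hk k x = h x"
  shows "(\<lambda>k. risk n \<pi> (hk k)) \<longlonglongrightarrow> risk n \<pi> h"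
proof -
  interpret prob_space "XY_law n \<pi>" by (rule prob_space_XY_law[OF \<pi>])
  let ?X = "space (XY_law n \<pi>)"
  have sp: "?X = space (data_space n)" by (rule sets_eq_imp_space_eq[OF sets_XY_law[OF \<pi>]])
  have S: "{p\<in>?X. g (fst p) \<noteq> snd p} \<in> sets (XY_law n \<pi>)" if "g \<in> H1 n m" for g
    using sets_error[OF measurable_H1[OF that]] unfolding sp sets_XY_law[OF \<pi>] .
  have risk: "risk n \<pi> g = (\<integral>p. indicat_real {p\<in>?X. g (fst p) \<noteq> snd p} p \<partial>XY_law n \<pi>)"
    if "g \<in> H1 n m" for g
    using S[OF that] by (simp add: risk_def)
  have "(\<lambda>k. \<integral>p. indicat_real {p\<in>?X. hk k (fst p) \<noteq> snd p} p \<partial>XY_law n \<pi>)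
      \<longlonglongrightarrow> (\<integral>p. indicat_real {p\<in>?X. h (fst p) \<noteq> snd p} p \<partial>XY_law n \<pi>)"
  proof (rule integral_dominated_convergence[where w = "\<lambda>_. 1"])
    show "AE p in XY_law n \<pi>. (\<lambda>k. indicat_real {p\<in>?X. hk k (fst p) \<noteq> snd p} p)
        \<longlonglongrightarrow> indicat_real {p\<in>?X. h (fst p) \<noteq> snd p} p"
    proof (rule AE_I2, rule tendsto_eventually)
      fix p
      show "\<forall>\<^sub>F k in sequentially. indicat_real {p\<in>?X. hk k (fst p) \<noteq> snd p} p
          = indicat_real {p\<in>?X. h (fst p) \<noteq> snd p} p"
        using lim[of "fst p"] by eventually_elim (simp add: indicator_def)
    qed
    show "indicat_real {p\<in>?X. h (fst p) \<noteq> snd p} \<in> borel_measurable (XY_law n \<pi>)"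
      by (intro borel_measurable_indicator S h)
    show "indicat_real {p\<in>?X. hk k (fst p) \<noteq> snd p} \<in> borel_measurable (XY_law n \<pi>)" for k
      by (intro borel_measurable_indicator S h)
  qed (auto simp: indicator_def)
  then show ?thesis by (simp add: risk h)
qed

lemma emp_risk_tendsto:
  assumes "\<And>x. \<forall>\<^sub>F k in sequentially. hk k x = h x"
  shows "(\<lambda>k. emp_risk N (hk k) D) \<longlonglongrightarrow> emp_risk N h D"
proof (rule tendsto_eventually)
  have "\<forall>\<^sub>F k in sequentially. \<forall>i\<in>{..<N}. hk k (fst (D i)) = h (fst (D i))"
    by (intro eventually_ball_finite) (auto intro: assms)
  then show "\<forall>\<^sub>F k in sequentially. emp_risk N (hk k) D = emp_risk N h D"
    by eventually_elim (simp add: emp_risk_def)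
qed

text \<open>The origin of 15. The exponent equals \<open>4 * n\<^sup>2 - 3\<close>, and
  \<open>ln (2 * N + 1) \<le> 3 * ln N\<close>; inserting the factor \<open>ln n \<ge> 1/2\<close>
  doubles the resulting 12 to 24. Absorbing the \<open>ln 2\<close> from \<open>2 / \<delta>\<close>
  makes it 25, and \<open>2 * sqrt (2 * 25) = sqrt 200 \<le> 15\<close>.\<close>

lemma deviation_radius_bound:
  assumes n: "n \<ge> 2" and N: "N \<ge> 2" and \<delta>: "0 < \<delta>" "\<delta> < 1"
  shows "2 * sqrt (2 * (ln (real ((2 * N + 1) ^ (2 * (2 * n - 2) * (n + 1) + 1))) + ln (2 / \<delta>)) / real N)
    \<le> 15 * sqrt ((real n ^ 2 * ln (real n) * ln (real N) + ln (1 / \<delta>)) / real N)"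
proof -
  define d where "d = 2 * (2 * n - 2) * (n + 1) + 1"
  define T where "T = real n ^ 2 * ln (real n) * ln (real N) + ln (1 / \<delta>)"
  have ln2: "ln (2::real) \<ge> 1/2" "ln (2::real) \<le> 1"
    using ln_2_less_1 ln2_ge_two_thirds by auto
  have lnn: "ln (real n) \<ge> 1/2" "ln (real N) \<ge> 1/2"
    using n N by (intro order_trans[OF ln2(1)]; simp)+
  have "real d \<le> 4 * real n ^ 2"
  proof -
    obtain k where k: "n = k + 2" using n by (metis add.commute le_Suc_ex)
    have "d \<le> 4 * n ^ 2" unfolding d_def k by (simp add: power2_eq_square algebra_simps)
    then show ?thesis by (metis of_nat_le_iff of_nat_mult of_nat_numeral of_nat_power)
  qed
  moreover have "ln (2 * real N + 1) \<le> 3 * ln (real N)"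
  proof -
    have "2 * real N + 1 \<le> real N ^ 3"
    proof -
      have "4 * real N \<le> real N ^ 3"
        using N power_mono[of 2 "real N" 2] by (simp add: power3_eq_cube power2_eq_square mult_mono)
      then show ?thesis using N by linarith
    qed
    then have "ln (2 * real N + 1) \<le> ln (real N ^ 3)" using N by (intro ln_mono) auto
    then show ?thesis using N by (simp add: ln_realpow)
  qed
  ultimately have "real d * ln (2 * real N + 1) \<le> 4 * real n ^ 2 * (3 * ln (real N))"
    using lnn N by (intro mult_mono) auto
  also have "\<dots> = 24 * (real n ^ 2 * ln (real N)) * (1/2)" by simp
  also have "\<dots> \<le> 24 * (real n ^ 2 * ln (real N)) * ln (real n)"
    using lnn by (intro mult_left_mono) auto
  finally have a: "real d * ln (2 * real N + 1) \<le> 24 * (real n ^ 2 * ln (real n) * ln (real N))"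
    by (simp add: algebra_simps)
  have "4 * (1/2) * (1/2) \<le> real n ^ 2 * ln (real n) * ln (real N)"
    using lnn n power_mono[of 2 "real n" 2] by (intro mult_mono) auto
  then have b: "ln 2 \<le> real n ^ 2 * ln (real n) * ln (real N)" using ln2 by linarith
  have c: "ln (2 / \<delta>) = ln 2 + ln (1 / \<delta>)" "ln (1 / \<delta>) \<ge> 0"
    using \<delta> by (simp_all add: ln_div)
  have "ln (real ((2 * N + 1) ^ d)) = real d * ln (2 * real N + 1)"
    using N by (simp add: ln_realpow add.commute)
  then have "ln (real ((2 * N + 1) ^ d)) + ln (2 / \<delta>) \<le> 25 * T"
    using a b c by (simp add: T_def)
  then have "2 * (ln (real ((2 * N + 1) ^ d)) + ln (2 / \<delta>)) / N \<le> 50 * T / N"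
    by (intro divide_right_mono) auto
  then have "2 * sqrt (2 * (ln (real ((2 * N + 1) ^ d)) + ln (2 / \<delta>)) / N) \<le> 2 * sqrt (50 * (T / N))"
    by simp
  also have "\<dots> = sqrt 200 * sqrt (T / N)"
    using real_sqrt_mult[of 4 "50 * (T / N)"] real_sqrt_mult[of 200 "T / N"] by simp
  also have "\<dots> \<le> 15 * sqrt (T / N)"
  proof (rule mult_right_mono)
    show "sqrt 200 \<le> (15::real)" by (rule real_le_lsqrt) auto
    have "T \<ge> 0" using b c ln2 by (simp add: T_def)
    then show "0 \<le> sqrt (T / N)" by simp
  qed
  finally show ?thesis unfolding d_def T_def .
qed

text \<open>The guarantee is given on a measurable event \<open>E\<close>: \<open>erm\<close> is an
  arbitrary selection of minimisers, so the set of samples on which the bound holds may fail to be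
  measurable.\<close>

theorem theorem4p3:
  shows "\<exists>C::real. C > 0 \<and>
    (\<forall>(n::nat) (B::real) (\<pi>0 :: (nat \<times> real \<times> real) measure) (N::nat)
       (erm :: (nat \<Rightarrow> (nat \<Rightarrow> real) \<times> bool) \<Rightarrow> ((nat \<Rightarrow> real) \<Rightarrow> bool)) (\<delta>::real).
      n \<ge> 2 \<longrightarrow> B > 0 \<longrightarrow>
      prob_space \<pi>0 \<longrightarrow>
      sets \<pi>0 = sets (count_space UNIV \<Otimes>\<^sub>M borel \<Otimes>\<^sub>M borel) \<longrightarrow>
      (AE \<theta> in \<pi>0. \<theta> \<in> Theta n B) \<longrightarrow>
      N \<ge> 2 \<longrightarrow>
      (\<forall>D \<in> space (train_law n \<pi>0 N).
          erm D \<in> H1 n (2*n - 2) \<and>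
          (\<forall>h \<in> H1 n (2*n - 2). emp_risk N (erm D) D \<le> emp_risk N h D)) \<longrightarrow>
      0 < \<delta> \<longrightarrow> \<delta> < 1 \<longrightarrow>
      (\<exists>E \<in> sets (train_law n \<pi>0 N).
          measure (train_law n \<pi>0 N) E \<ge> 1 - \<delta> \<and>
          (\<forall>D \<in> E. risk n \<pi>0 (erm D) \<le>
              real n * exp (- real n * B^2 / 8)
              + C * sqrt ((real n ^ 2 * ln (real n) * ln (real N) + ln (1 / \<delta>)) / real N))))"
proof (intro exI[of _ 15] conjI allI impI)
  fix n :: nat and B :: real and \<pi> :: "(nat \<times> real \<times> real) measure" and N :: nat and erm and \<delta> :: real
  assume n: "n \<ge> 2" and B: "B > 0"
    and \<pi>: "prob_space \<pi>" "sets \<pi> = sets (count_space UNIV \<Otimes>\<^sub>M borel \<Otimes>\<^sub>M borel)"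
    and AE: "AE \<theta> in \<pi>. \<theta> \<in> Theta n B" and N: "N \<ge> 2"
    and erm: "\<forall>D \<in> space (train_law n \<pi> N). erm D \<in> H1 n (2*n - 2) \<and>
          (\<forall>h \<in> H1 n (2*n - 2). emp_risk N (erm D) D \<le> emp_risk N h D)"
    and \<delta>: "0 < \<delta>" "\<delta> < 1"
  let ?M = "XY_law n \<pi>"
  let ?X = "space ?M"
  let ?H = "H1 n (2 * n - 2)"
  interpret M: prob_space ?M by (rule prob_space_XY_law[OF \<pi>])
  have sp: "?X = space (data_space n)" by (rule sets_eq_imp_space_eq[OF sets_XY_law[OF \<pi>]])
  have sets_err: "{p\<in>?X. g (fst p) \<noteq> snd p} \<in> sets ?M" if "g \<in> ?H" for g
    using sets_error[OF measurable_H1[OF that]] unfolding sp sets_XY_law[OF \<pi>] .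
  obtain hs where hs: "hs \<in> ?H" "risk n \<pi> hs \<le> n * exp (- real n * B\<^sup>2 / 8)"
    using exists_low_risk[OF n B \<pi> AE] by blast
  \<comment> \<open>Nonemptiness ensures that \<open>from_nat_into\<close> has exactly the rational
    class as its range.\<close>
  obtain g where g: "g \<in> H1_rat n (2 * n - 2)" using H1_rat_dense[OF hs(1)] by metis
  define f where "f = from_nat_into (H1_rat n (2 * n - 2))"
  have ran: "range f = H1_rat n (2 * n - 2)"
    unfolding f_def using g by (intro range_from_nat_into countable_H1_rat) auto
  then have f: "f k \<in> ?H" "range f \<subseteq> ?H" for k
    using H1_rat_subset by auto
  define S where "S = (2 * N + 1) ^ (2 * (2 * n - 2) * (n + 1) + 1)"
  \<comment> \<open>Solves \<open>S * exp (- N * e\<^sup>2 / 2) = \<delta> / 2\<close>; the two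
    failure events share \<open>\<delta>\<close>.\<close>
  define e where "e = sqrt (2 * (ln (real S) + ln (2 / \<delta>)) / real N)"
  have S: "real S \<ge> 1" unfolding S_def of_nat_power by (rule one_le_power) simp
  have rad: "ln (real S) + ln (2 / \<delta>) > 0"
    using S \<delta> by (intro add_nonneg_pos) auto
  then have e: "e > 0" unfolding e_def using N by simp
  have "- real N * e\<^sup>2 / 2 = - (ln (real S) + ln (2 / \<delta>))"
    using rad N by (simp add: e_def)
  then have "exp (- real N * e\<^sup>2 / 2) = exp (- ln (real S) + - ln (2 / \<delta>))" by simp
  also have "\<dots> = 1 / real S * (\<delta> / 2)"
    unfolding exp_add using S \<delta> by (simp add: exp_minus field_simps)
  finally have tail: "exp (- real N * e\<^sup>2 / 2) = 1 / real S * (\<delta> / 2)" .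
  define A1 where "A1 k = {p\<in>?X. f k (fst p) \<noteq> snd p}" for k
  \<comment> \<open>A constant sequence, hence growth 1. Passing to the complement of the error set
    turns the deviation into empirical risk minus risk, the direction needed for the comparison
    network.\<close>
  define A2 where "A2 k = ?X - {p\<in>?X. hs (fst p) \<noteq> snd p}" for k :: nat
  interpret V1: vc_class ?M A1 N S e
  proof
    show "A1 k \<in> M.events" for k unfolding A1_def by (rule sets_err[OF f(1)])
    show "card (range (\<lambda>k. {i\<in>{..<2*N}. z i \<in> A1 k})) \<le> S" for z
      unfolding A1_def S_def by (rule card_error_patterns_le[OF f(2)])
  qed (use N e in auto)
  interpret V2: vc_class ?M A2 N 1 e
  proof
    show "A2 k \<in> M.events" for k unfolding A2_def by (intro sets.compl_sets sets_err hs(1))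
    show "card (range (\<lambda>k::nat. {i\<in>{..<2*N}. z i \<in> A2 k})) \<le> 1" for z
      by (simp add: A2_def)
  qed (use N e in auto)
  have train: "train_law n \<pi> N = V1.P1" by (simp add: train_law_def)
  define E1 where "E1 = {D\<in>space V1.P1. \<exists>k. V1.dev k D > e}"
  define E2 where "E2 = {D\<in>space V1.P1. \<exists>k. V2.dev k D > e}"
  have E [measurable]: "E1 \<in> sets V1.P1" "E2 \<in> sets V1.P1"
    unfolding E1_def E2_def by measurable
  have "V1.P1.prob E1 \<le> S * (1 / real S * (\<delta> / 2))"
    unfolding E1_def tail[symmetric] by (rule V1.uniform_deviation)
  moreover have "V1.P1.prob E2 \<le> 1 * (1 / real S * (\<delta> / 2))"
    unfolding E2_def tail[symmetric] using V2.uniform_deviation by simp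
  moreover have "1 / real S * (\<delta> / 2) \<le> 1 * (\<delta> / 2)"
    using S \<delta> by (intro mult_right_mono) auto
  ultimately have "V1.P1.prob E1 + V1.P1.prob E2 \<le> \<delta>" using S by simp
  then have "V1.P1.prob (E1 \<union> E2) \<le> \<delta>"
    using measure_Un_le[OF E] by linarith
  then have prob: "V1.P1.prob (space V1.P1 - (E1 \<union> E2)) \<ge> 1 - \<delta>"
    by (subst V1.P1.prob_compl) auto
  have "risk n \<pi> (erm D) \<le> n * exp (- real n * B\<^sup>2 / 8)
      + 15 * sqrt ((real n ^ 2 * ln (real n) * ln (real N) + ln (1 / \<delta>)) / real N)"
    if "D \<in> space V1.P1 - (E1 \<union> E2)" for D
  proof -
    have D: "D \<in> space V1.P1" "D \<in> space (train_law n \<pi> N)" using that by (auto simp: train)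
    have DX: "D i \<in> ?X" if "i < N" for i
      using D(1) that by (auto simp: space_PiM)
    have dev1: "V1.dev k D = risk n \<pi> (f k) - emp_risk N (f k) D" for k
    proof -
      have "(\<Sum>i<N. indicat_real (A1 k) (D i)) = (\<Sum>i<N. if f k (fst (D i)) \<noteq> snd (D i) then 1 else 0)"
        using DX by (intro sum.cong) (auto simp: A1_def indicator_def)
      then show ?thesis by (simp only: V1.dev_def risk_def emp_risk_def A1_def)
    qed
    have "(\<Sum>i<N. indicat_real (A2 0) (D i)) = (\<Sum>i<N. 1 - (if hs (fst (D i)) \<noteq> snd (D i) then 1 else 0))"
      using DX by (intro sum.cong) (auto simp: A2_def indicator_def)
    also have "\<dots> / N = 1 - emp_risk N hs D"
      using N by (simp add: emp_risk_def sum_subtractf diff_divide_distrib)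
    finally have "V2.dev 0 D = emp_risk N hs D - risk n \<pi> hs"
      using M.prob_compl[OF sets_err[OF hs(1)]] by (simp add: V2.dev_def A2_def risk_def)
    moreover have "V2.dev 0 D \<le> e" using that by (auto simp: E2_def not_less)
    ultimately have 1: "emp_risk N hs D \<le> risk n \<pi> hs + e" by simp
    have 2: "emp_risk N (erm D) D \<le> emp_risk N hs D" and H: "erm D \<in> ?H"
      using erm D(2) hs(1) by auto
    \<comment> \<open>Avoiding \<open>E1\<close> controls the enumerated rational networks only; the
      non-strict bound survives the limit towards \<open>erm D\<close>, along which risk and
      empirical risk both converge.\<close>
    obtain hk where hk: "\<And>k. hk k \<in> H1_rat n (2 * n - 2)" "\<And>x. \<forall>\<^sub>F k in sequentially. hk k x = erm D x"
      using H1_rat_dense[OF H] by blast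
    have "risk n \<pi> (hk k) - emp_risk N (hk k) D \<le> e" for k
    proof -
      obtain i where i: "hk k = f i" using hk(1)[of k] ran by auto
      have "V1.dev i D \<le> e" using that by (auto simp: E1_def not_less)
      then show ?thesis unfolding i dev1 .
    qed
    moreover have "(\<lambda>k. risk n \<pi> (hk k) - emp_risk N (hk k) D) \<longlonglongrightarrow> risk n \<pi> (erm D) - emp_risk N (erm D) D"
      using hk(1) H1_rat_subset
      by (intro tendsto_diff risk_tendsto[OF \<pi> _ H hk(2)] emp_risk_tendsto hk(2)) blast
    ultimately have "risk n \<pi> (erm D) - emp_risk N (erm D) D \<le> e"
      by (intro LIMSEQ_le_const2) auto
    \<comment> \<open>One \<open>e\<close> for passing from risk to empirical risk at
      \<open>erm D\<close>, and one for the way back at \<open>hs\<close>, with minimality in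
      between.\<close>
    then have "risk n \<pi> (erm D) \<le> n * exp (- real n * B\<^sup>2 / 8) + 2 * e"
      using 1 2 hs(2) by linarith
    also have "2 * e \<le> 15 * sqrt ((real n ^ 2 * ln (real n) * ln (real N) + ln (1 / \<delta>)) / real N)"
      unfolding e_def S_def by (rule deviation_radius_bound[OF n N \<delta>])
    finally show ?thesis by simp
  qed
  then show "\<exists>E \<in> sets (train_law n \<pi> N). measure (train_law n \<pi> N) E \<ge> 1 - \<delta> \<and>
          (\<forall>D \<in> E. risk n \<pi> (erm D) \<le> real n * exp (- real n * B^2 / 8)
              + 15 * sqrt ((real n ^ 2 * ln (real n) * ln (real N) + ln (1 / \<delta>)) / real N))"
    using prob unfolding train by (intro bexI[of _ "space V1.P1 - (E1 \<union> E2)"]) auto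
qed simp

end
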